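(* Let $X$ be a biquandle, $R$ a commutative ring with identity, and $\beta=(A,B,C,D,U,V,\delta,w)$ a biquandle virtual bracket over $X$ with values in $R$. For any $X$-coloring $f$ of a diagram of an oriented (classical or) virtual link $L$, the state sum \[\beta_f=\sum_{S\ \text{state}}\beta_S\in R\] is invariant under $X$-colored virtual Reidemeister moves. That is, if $\mathcal D'$ is obtained from an oriented virtual link diagram $\mathcal D$ by an oriented virtual Reidemeister move, $f$ is an $X$-coloring of $\mathcal D$, and $f'$ is the corresponding $X$-coloring of $\mathcal D'$ (the unique one agreeing with $f$ outside the region of the move), then $\beta_f=\beta_{f'}$.
   Context: **Biquandle.** A biquandle is a set $X$ with two operations $\underline{\triangleright},\overline{\triangleright}:X\times X\to X$, written $x^y:=x\,\underline{\triangleright}\,y$ and $x_y:=x\,\overline{\triangleright}\,y$, such that for all $x,y,z\in X$: (i) $x^x=x_x$; (ii) the maps $\alpha_x(y)=y_x$ and $\beta_x(y)=y^x$ on $X$, and $S(x,y)=(y_x,x^y)$ on $X\times X$, are invertible; (iii) $(x\underline{\triangleright}y)\underline{\triangleright}(z\underline{\triangleright}y)=(x\underline{\triangleright}z)\underline{\triangleright}(y\overline{\triangleright}z)$, $(x\underline{\triangleright}y)\overline{\triangleright}(z\underline{\triangleright}y)=(x\overline{\triangleright}z)\underline{\triangleright}(y\overline{\triangleright}z)$, $(x\overline{\triangleright}y)\overline{\triangleright}(z\overline{\triangleright}y)=(x\overline{\triangleright}z)\overline{\triangleright}(y\underline{\triangleright}z)$. **Virtual links.** An oriented virtual link diagram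 is an oriented planar link diagram whose double points are classical (over/under) crossings or virtual crossings. Oriented virtual links are equivalence classes of such diagrams under planar isotopy and the oriented virtual Reidemeister moves: the classical moves I, II, III (with all orientations), their purely virtual analogues vI, vII, vIII (all crossings virtual), and the mixed move v (a strand with two virtual crossings is moved past a classical crossing). **Colorings.** An $X$-coloring of a diagram assigns an element of $X$ to each semiarc (portion between classical crossings; labels pass through virtual crossings unchanged) so that at every classical crossing, drawn with both strands directed downward, the following holds: if $x$ is the label of the left-hand semiarc of the under-strand and $y$ is the label of the left-hand semiarc of the over-strand, then the right-hand semiarc of the under-strand has label $x\underline{\triangleright}y$ and that of the over-strand has label $y\overline{\triangleright}x$. This rule applies at both positive and negative crossings. A crossing drawn downward is positive if the over-strand runs from upper right to lower left, and negative if it runs from upper left to lower right. We call $(x,y)$ the color pair of the crossing. For each move, every coloring before the move corresponds to a unique coloring after it that agrees outside the move region. **Biquandle virtual bracket.** It consists of maps $A,B,C,D,U,V:X\times X\to R$ and elements $\delta\in R$, $w\in R^\times$ such that for all $x,y,z\in X$ the following hold. (i) $w=\delta A_{x,x}+B_{x,x}+V_{x,x}$ and $w^{-1}=\delta C_{x,x}+D_{x,x}+U_{x,x}$. (ii) Omitting the index $x,y$ on every factor: $1=AC+VU$, $1=BD+VU$, $0=AU+VC$, $0=BU+VD$, $0=\delta BD+AD+BC$, $0=\delta AC+AD+BC$. (iii) For letters $P,Q,T\in\{A,B,V\}$ write $[PQT]:=P_{x,y}\,Q_{x^y,z_y}\,T_{y,z}$ and $[PQT]':=P_{y_x,z_x}\,Q_{x,z}\,T_{x^z,y^z}$.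 Then: 1. $[AAA]+[VAV]=[AAA]'+[VAV]'$ 2. $[AAB]+[BAA]+\delta[BAB]+[BAV]+[BBB]+[BVB]+[VAB]=[ABA]'$ 3. $[ABA]=[AAB]'+[BAA]'+\delta[BAB]'+[BAV]'+[BBB]'+[BVB]'+[VAB]'$ 4. $[AVA]=[AAV]'+[VAA]'$ 5. $[AAV]+[VAA]=[AVA]'$ 6. $[BBA]+[BVV]=[ABB]'+[VVB]'$ 7. $[ABB]+[VVB]=[BBA]'+[BVV]'$ 8. $[BBV]+[BVA]=[ABV]'$ 9. $[ABV]=[BBV]'+[BVA]'$ 10. $[VBA]=[AVB]'+[VBB]'$ 11. $[AVB]+[VBB]=[VBA]'$ 12. $[VVA]=[AVV]'$ 13. $[AVV]=[VVA]'$ 14. $[VBV]=[VBV]'$ 15. $[VVV]=[VVV]'$ **States and state sum.** Let $f$ be an $X$-coloring of a diagram with $p$ positive and $n$ negative classical crossings. A state $S$ is a choice, at each classical crossing, of one of three replacements: the smoothing compatible with orientation (without crossing, joining each incoming end to the outgoing end of the other strand); the smoothing against orientation (joining the two incoming ends to each other and the two outgoing ends to each other); or replacement by a virtual crossing. For a crossing with color pair $(x,y)$ these choices have coefficients $A_{x,y},B_{x,y},V_{x,y}$ respectively if the crossing is positive, and $C_{x,y},D_{x,y},U_{x,y}$ respectively if it is negative. Then $\beta_S$ is the product of the coefficients of all choices, times $\delta^k$, times $w^{n-p}$, where $k$ is the number of closed curves of the resulting diagram (curves may cross themselves and each other at virtual crossings). The state sum is over all $3^{n+p}$ states. *)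

theory Defs
  imports Main "HOL-Library.Multiset" "HOL-Library.FuncSet"
begin

section \<open>Biquandles and biquandle virtual brackets\<close>

text \<open>In the exponent notation, \<open>x \<rhd>\<^sub>u y\<close> is \<open>x\<^sup>y\<close> (underlined triangle) and \<open>x \<rhd>\<^sub>o y\<close> is
  \<open>x\<^sub>y\<close> (overlined triangle).\<close>

locale biquandle =
  fixes ut :: "'x \<Rightarrow> 'x \<Rightarrow> 'x"  (infixl "\<rhd>\<^sub>u" 70)
    and ot :: "'x \<Rightarrow> 'x \<Rightarrow> 'x"  (infixl "\<rhd>\<^sub>o" 70)
  assumes diag: "x \<rhd>\<^sub>u x = x \<rhd>\<^sub>o x"
    and bij_alpha: "bij (\<lambda>y. y \<rhd>\<^sub>o x)"
    and bij_beta: "bij (\<lambda>y. y \<rhd>\<^sub>u x)"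
    and bij_S: "bij (\<lambda>(x, y). (y \<rhd>\<^sub>o x, x \<rhd>\<^sub>u y))"
    and exchange_uu: "(x \<rhd>\<^sub>u y) \<rhd>\<^sub>u (z \<rhd>\<^sub>u y) = (x \<rhd>\<^sub>u z) \<rhd>\<^sub>u (y \<rhd>\<^sub>o z)"
    and exchange_uo: "(x \<rhd>\<^sub>u y) \<rhd>\<^sub>o (z \<rhd>\<^sub>u y) = (x \<rhd>\<^sub>o z) \<rhd>\<^sub>u (y \<rhd>\<^sub>o z)"
    and exchange_oo: "(x \<rhd>\<^sub>o y) \<rhd>\<^sub>o (z \<rhd>\<^sub>o y) = (x \<rhd>\<^sub>o z) \<rhd>\<^sub>o (y \<rhd>\<^sub>u z)"
begin

definition lbr :: "('x \<Rightarrow> 'x \<Rightarrow> 'r) \<Rightarrow> ('x \<Rightarrow> 'x \<Rightarrow> 'r) \<Rightarrow> ('x \<Rightarrow> 'x \<Rightarrow> 'r) \<Rightarrow>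
    'x \<Rightarrow> 'x \<Rightarrow> 'x \<Rightarrow> 'r::times" where
  "lbr P Q T x y z = P x y * Q (x \<rhd>\<^sub>u y) (z \<rhd>\<^sub>o y) * T y z"

definition rbr :: "('x \<Rightarrow> 'x \<Rightarrow> 'r) \<Rightarrow> ('x \<Rightarrow> 'x \<Rightarrow> 'r) \<Rightarrow> ('x \<Rightarrow> 'x \<Rightarrow> 'r) \<Rightarrow>
    'x \<Rightarrow> 'x \<Rightarrow> 'x \<Rightarrow> 'r::times" where
  "rbr P Q T x y z = P (y \<rhd>\<^sub>o x) (z \<rhd>\<^sub>o x) * Q x z * T (x \<rhd>\<^sub>u z) (y \<rhd>\<^sub>u z)"

end

definition unit_inv :: "'r::comm_ring_1 \<Rightarrow> 'r" where
  "unit_inv u = (THE v. u * v = 1)"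

definition unit_powi :: "'r::comm_ring_1 \<Rightarrow> int \<Rightarrow> 'r" where
  "unit_powi u k = (if k \<ge> 0 then u ^ nat k else unit_inv u ^ nat (- k))"

locale biquandle_virtual_bracket = biquandle ut ot
  for ut :: "'x \<Rightarrow> 'x \<Rightarrow> 'x"  (infixl "\<rhd>\<^sub>u" 70)
    and ot :: "'x \<Rightarrow> 'x \<Rightarrow> 'x"  (infixl "\<rhd>\<^sub>o" 70) +
  fixes A B C D U V :: "'x \<Rightarrow> 'x \<Rightarrow> 'r::comm_ring_1"
    and \<delta> w :: 'r
  assumes w_unit: "w dvd 1"
    and w: "w = \<delta> * A x x + B x x + V x x"
    and w_inv: "unit_inv w = \<delta> * C x x + D x x + U x x"
    and ii1: "1 = A x y * C x y + V x y * U x y"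
    and ii2: "1 = B x y * D x y + V x y * U x y"
    and ii3: "0 = A x y * U x y + V x y * C x y"
    and ii4: "0 = B x y * U x y + V x y * D x y"
    and ii5: "0 = \<delta> * B x y * D x y + A x y * D x y + B x y * C x y"
    and ii6: "0 = \<delta> * A x y * C x y + A x y * D x y + B x y * C x y"
    and iii1: "lbr A A A x y z + lbr V A V x y z = rbr A A A x y z + rbr V A V x y z"
    and iii2: "lbr A A B x y z + lbr B A A x y z + \<delta> * lbr B A B x y z + lbr B A V x y z
      + lbr B B B x y z + lbr B V B x y z + lbr V A B x y z = rbr A B A x y z"
    and iii3: "lbr A B A x y z = rbr A A B x y z + rbr B A A x y z + \<delta> * rbr B A B x y z
      + rbr B A V x y z + rbr B B B x y z + rbr B V B x y z + rbr V A B x y z"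
    and iii4: "lbr A V A x y z = rbr A A V x y z + rbr V A A x y z"
    and iii5: "lbr A A V x y z + lbr V A A x y z = rbr A V A x y z"
    and iii6: "lbr B B A x y z + lbr B V V x y z = rbr A B B x y z + rbr V V B x y z"
    and iii7: "lbr A B B x y z + lbr V V B x y z = rbr B B A x y z + rbr B V V x y z"
    and iii8: "lbr B B V x y z + lbr B V A x y z = rbr A B V x y z"
    and iii9: "lbr A B V x y z = rbr B B V x y z + rbr B V A x y z"
    and iii10: "lbr V B A x y z = rbr A V B x y z + rbr V B B x y z"
    and iii11: "lbr A V B x y z + lbr V B B x y z = rbr V B A x y z"
    and iii12: "lbr V V A x y z = rbr A V V x y z"
    and iii13: "lbr A V V x y z = rbr V V A x y z"
    and iii14: "lbr V B V x y z = rbr V B V x y z"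
    and iii15: "lbr V V V x y z = rbr V V V x y z"


section \<open>Oriented virtual link diagrams\<close>

text \<open>A diagram, up to planar isotopy, is given by an oriented planar diagram code. The edges carry
  names; each edge leaves exactly one node and enters exactly one node. A node is either a crossing
  or a marked point in the interior of an arc. Marked points carry no information: they represent
  circles without crossings, and they allow a local picture to contain a plain arc.

  \<open>Cr k ul ur ll lr\<close> is a crossing turned so that both strands are directed downward, with the
  four edges at the upper left, upper right, lower left and lower right. Its two strands are
  \<open>ul \<rightarrow> lr\<close> and \<open>ur \<rightarrow> ll\<close>; the over-strand is \<open>ur \<rightarrow> ll\<close> if the crossing is positive and
  \<open>ul \<rightarrow> lr\<close> if it is negative. \<open>Pt a b\<close> is a marked point entered by \<open>a\<close> and left by \<open>b\<close>.\<close>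

datatype kind = Positive | Negative | Virtual

datatype 'e node = Pt 'e 'e | Cr kind 'e 'e 'e 'e

text \<open>\<open>In e\<close> is the half of the edge \<open>e\<close> at the node entered by \<open>e\<close>, \<open>Out e\<close> the half at the node
  left by \<open>e\<close>.\<close>

datatype 'e half = In 'e | Out 'e

fun opposite :: "'e half \<Rightarrow> 'e half" where
  "opposite (In e) = Out e"
| "opposite (Out e) = In e"

text \<open>The half-edges around a node, counterclockwise.\<close>

fun halves :: "'e node \<Rightarrow> 'e half list" where
  "halves (Pt a b) = [In a, Out b]"
| "halves (Cr k ul ur ll lr) = [In ul, Out ll, Out lr, In ur]"

definition edges :: "'e node multiset \<Rightarrow> 'e set" where
  "edges K = (\<Union>n\<in>set_mset K. set_node n)"

definition code :: "'e node multiset \<Rightarrow> bool" where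
  "code K \<longleftrightarrow> (\<forall>e\<in>edges K. count (\<Sum>n\<in>#K. mset (halves n)) (In e) = 1 \<and>
                           count (\<Sum>n\<in>#K. mset (halves n)) (Out e) = 1)"

text \<open>Number of connected components of the graph with vertex set \<open>M\<close> and adjacency \<open>r\<close>.\<close>

definition components :: "'v set \<Rightarrow> ('v \<times> 'v) set \<Rightarrow> nat" where
  "components M r = card (M // (r \<union> r\<inverse>)\<^sup>*)"

definition pieces :: "'e node multiset \<Rightarrow> nat" where
  "pieces K = components (edges K) {(a, b). \<exists>n\<in>#K. a \<in> set_node n \<and> b \<in> set_node n}"

text \<open>The boundary of a face is traced by running along an edge to its other half and turning to
  the next half-edge, counterclockwise, at the node reached.\<close>

definition faces :: "'e node multiset \<Rightarrow> nat" where
  "faces K = components (\<Union>n\<in>set_mset K. set (halves n))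
     {(h, h'). \<exists>n\<in>#K. (opposite h, h') \<in> set (zip (halves n) (rotate1 (halves n)))}"

text \<open>Euler's formula, with the faces counted separately for each connected piece. Every piece
  contributes at most 2 to \<open>V - E + F\<close>, so equality says that every piece has genus 0.\<close>

definition planar :: "'e node multiset \<Rightarrow> bool" where
  "planar K \<longleftrightarrow> size K + faces K = card (edges K) + 2 * pieces K"

definition link_diagram :: "'e node multiset \<Rightarrow> bool" where
  "link_diagram K \<longleftrightarrow> code K \<and> planar K"


section \<open>Colorings\<close>

fun color_pair :: "('e \<Rightarrow> 'x) \<Rightarrow> 'e node \<Rightarrow> 'x \<times> 'x" where
  "color_pair f (Cr Positive ul ur ll lr) = (f ul, f ll)"
| "color_pair f (Cr Negative ul ur ll lr) = (f ll, f ul)"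
| "color_pair f n = undefined"

fun colored_at :: "('x \<Rightarrow> 'x \<Rightarrow> 'x) \<Rightarrow> ('x \<Rightarrow> 'x \<Rightarrow> 'x) \<Rightarrow> ('e \<Rightarrow> 'x) \<Rightarrow> 'e node \<Rightarrow> bool" where
  "colored_at ut ot f (Pt a b) \<longleftrightarrow> f a = f b"
| "colored_at ut ot f (Cr Virtual ul ur ll lr) \<longleftrightarrow> f ul = f lr \<and> f ur = f ll"
| "colored_at ut ot f (Cr Positive ul ur ll lr) \<longleftrightarrow>
     f lr = ut (f ul) (f ll) \<and> f ur = ot (f ll) (f ul)"
| "colored_at ut ot f (Cr Negative ul ur ll lr) \<longleftrightarrow>
     f ur = ut (f ll) (f ul) \<and> f lr = ot (f ul) (f ll)"

definition coloring ::
    "('x \<Rightarrow> 'x \<Rightarrow> 'x) \<Rightarrow> ('x \<Rightarrow> 'x \<Rightarrow> 'x) \<Rightarrow> 'e node multiset \<Rightarrow> ('e \<Rightarrow> 'x) \<Rightarrow> bool" where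
  "coloring ut ot K f \<longleftrightarrow> (\<forall>n\<in>#K. colored_at ut ot f n)"


section \<open>States and the state sum\<close>

definition crossings :: "kind \<Rightarrow> 'e node multiset \<Rightarrow> 'e node set" where
  "crossings k K = {n. n \<in># K \<and> (\<exists>ul ur ll lr. n = Cr k ul ur ll lr)}"

text \<open>No node occurs twice in a code, so the classical crossings may be collected in a set.\<close>

definition classical :: "'e node multiset \<Rightarrow> 'e node set" where
  "classical K = crossings Positive K \<union> crossings Negative K"

datatype replacement = Along | Against | Virtualize

text \<open>The pairs of edges that become connected at a node.\<close>

fun joins :: "replacement \<Rightarrow> 'e node \<Rightarrow> ('e \<times> 'e) set" where
  "joins s (Pt a b) = {(a, b)}"
| "joins s (Cr k ul ur ll lr) =
     (if k = Virtual \<or> s = Virtualize then {(ul, lr), (ur, ll)}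
      else if s = Along then {(ul, ll), (ur, lr)}
      else {(ul, ur), (ll, lr)})"

text \<open>Every half-edge is joined to exactly one other, so the closed curves of the resulting diagram
  are the connected components of its edges.\<close>

definition closed_curves :: "'e node multiset \<Rightarrow> ('e node \<Rightarrow> replacement) \<Rightarrow> nat" where
  "closed_curves K S = components (edges K) (\<Union>n\<in>set_mset K. joins (S n) n)"

definition coefficient :: "('x \<Rightarrow> 'x \<Rightarrow> 'r) \<Rightarrow> ('x \<Rightarrow> 'x \<Rightarrow> 'r) \<Rightarrow> ('x \<Rightarrow> 'x \<Rightarrow> 'r) \<Rightarrow>
    ('x \<Rightarrow> 'x \<Rightarrow> 'r) \<Rightarrow> ('x \<Rightarrow> 'x \<Rightarrow> 'r) \<Rightarrow> ('x \<Rightarrow> 'x \<Rightarrow> 'r) \<Rightarrow>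
    ('e \<Rightarrow> 'x) \<Rightarrow> replacement \<Rightarrow> 'e node \<Rightarrow> 'r" where
  "coefficient A B C D U V f s n = (case color_pair f n of (x, y) \<Rightarrow>
     if \<exists>ul ur ll lr. n = Cr Positive ul ur ll lr
     then (case s of Along \<Rightarrow> A x y | Against \<Rightarrow> B x y | Virtualize \<Rightarrow> V x y)
     else (case s of Along \<Rightarrow> C x y | Against \<Rightarrow> D x y | Virtualize \<Rightarrow> U x y))"

definition state_sum :: "('x \<Rightarrow> 'x \<Rightarrow> 'r) \<Rightarrow> ('x \<Rightarrow> 'x \<Rightarrow> 'r) \<Rightarrow> ('x \<Rightarrow> 'x \<Rightarrow> 'r) \<Rightarrow>
    ('x \<Rightarrow> 'x \<Rightarrow> 'r) \<Rightarrow> ('x \<Rightarrow> 'x \<Rightarrow> 'r) \<Rightarrow> ('x \<Rightarrow> 'x \<Rightarrow> 'r) \<Rightarrow> 'r \<Rightarrow> 'r \<Rightarrow>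
    'e node multiset \<Rightarrow> ('e \<Rightarrow> 'x) \<Rightarrow> 'r::comm_ring_1" where
  "state_sum A B C D U V \<delta> w K f =
     (\<Sum>S\<in>classical K \<rightarrow>\<^sub>E UNIV.
        (\<Prod>n\<in>classical K. coefficient A B C D U V f (S n) n) * \<delta> ^ closed_curves K S *
        unit_powi w (int (card (crossings Negative K)) - int (card (crossings Positive K))))"


section \<open>Oriented virtual Reidemeister moves\<close>

text \<open>The local pictures are drawn without orientation; every strand then receives an arbitrary
  direction. \<open>True\<close> means that the strand is directed from its upper to its lower end.\<close>

definition arc :: "bool \<Rightarrow> 'e \<Rightarrow> 'e \<Rightarrow> 'e node" where
  "arc s t b = (if s then Pt t b else Pt b t)"

datatype height = FirstOver | SecondOver | NoneOver

fun swap :: "height \<Rightarrow> height" where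
  "swap FirstOver = SecondOver"
| "swap SecondOver = FirstOver"
| "swap NoneOver = NoneOver"

text \<open>\<open>xing c s s' nw ne sw se\<close> is the crossing of the first strand, with ends \<open>nw\<close> and \<open>se\<close> and
  direction \<open>s\<close>, and the second strand, with ends \<open>ne\<close> and \<open>sw\<close> and direction \<open>s'\<close>. It is turned
  by 0, 90, -90 or 180 degrees to make both strands point downward. If the two directions agree, the
  second strand then runs from upper right to lower left, otherwise the first one does.\<close>

definition xing_kind :: "height \<Rightarrow> bool \<Rightarrow> bool \<Rightarrow> kind" where
  "xing_kind c s s' = (case c of
     FirstOver \<Rightarrow> (if s = s' then Negative else Positive)
   | SecondOver \<Rightarrow> (if s = s' then Positive else Negative)
   | NoneOver \<Rightarrow> Virtual)"

definition xing :: "height \<Rightarrow> bool \<Rightarrow> bool \<Rightarrow> 'e \<Rightarrow> 'e \<Rightarrow> 'e \<Rightarrow> 'e \<Rightarrow> 'e node" where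
  "xing c s s' nw ne sw se =
     (if s then if s' then Cr (xing_kind c s s') nw ne sw se
                else Cr (xing_kind c s s') sw nw se ne
      else if s' then Cr (xing_kind c s s') ne se nw sw
           else Cr (xing_kind c s s') se sw ne nw)"

text \<open>Heights at the crossings of strands 1 and 2, of strands 1 and 3, and of strands 2 and 3.\<close>

text \<open>All crossings classical: one strand lies on top and one at the bottom, which excludes exactly
  the two cyclic patterns.\<close>

definition classical_triple :: "height \<Rightarrow> height \<Rightarrow> height \<Rightarrow> bool" where
  "classical_triple c12 c13 c23 \<longleftrightarrow>
     NoneOver \<notin> {c12, c13, c23} \<and>
     (c12, c13, c23) \<noteq> (FirstOver, SecondOver, FirstOver) \<and>
     (c12, c13, c23) \<noteq> (SecondOver, FirstOver, SecondOver)"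

definition virtual_triple :: "height \<Rightarrow> height \<Rightarrow> height \<Rightarrow> bool" where
  "virtual_triple c12 c13 c23 \<longleftrightarrow> c12 = NoneOver \<and> c13 = NoneOver \<and> c23 = NoneOver"

definition mixed_triple :: "height \<Rightarrow> height \<Rightarrow> height \<Rightarrow> bool" where
  "mixed_triple c12 c13 c23 \<longleftrightarrow>
     c12 \<noteq> NoneOver \<and> c13 = NoneOver \<and> c23 = NoneOver \<or>
     c12 = NoneOver \<and> c13 \<noteq> NoneOver \<and> c23 = NoneOver \<or>
     c12 = NoneOver \<and> c13 = NoneOver \<and> c23 \<noteq> NoneOver"

text \<open>\<open>reidemeister T M T'\<close>: the pictures \<open>T\<close> and \<open>T'\<close> are the two sides of a move, and \<open>M\<close> is the
  set of the edges that cross the boundary of the region. Each rule covers the classical and the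
  virtual version of a move, the rule \<open>III\<close> also the mixed move. The ends of strand \<open>i\<close> at the
  boundary are \<open>t\<^sub>i\<close> (top) and \<open>b\<^sub>i\<close> (bottom), in rule \<open>II\<close> with \<open>t\<^sub>1\<close>, \<open>b\<^sub>1\<close> on the left, in rule
  \<open>III\<close> in the order \<open>t\<^sub>1, t\<^sub>2, t\<^sub>3\<close> at the top and \<open>b\<^sub>3, b\<^sub>2, b\<^sub>1\<close> at the bottom. In rule \<open>III\<close> the
  crossing of strands 1 and 2 is the first one on the left and the last one on the right.\<close>

inductive reidemeister :: "'e node multiset \<Rightarrow> 'e set \<Rightarrow> 'e node multiset \<Rightarrow> bool" where
  I_left: "reidemeister {#arc s t b#} {t, b} {#xing c s s e t e b#}"
| I_right: "reidemeister {#arc s t b#} {t, b} {#xing c s s t e b e#}"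
| II: "reidemeister
    {#arc s1 t1 b1, arc s2 t2 b2#} {t1, b1, t2, b2}
    {#xing c s1 s2 t1 t2 p q, xing (swap c) s2 s1 p q b1 b2#}"
| III: "classical_triple c12 c13 c23 \<or> virtual_triple c12 c13 c23 \<or> mixed_triple c12 c13 c23 \<Longrightarrow>
    reidemeister
      {#xing c12 s1 s2 t1 t2 p q, xing c13 s1 s3 q t3 r b1, xing c23 s2 s3 p r b3 b2#}
      {t1, b1, t2, b2, t3, b3}
      {#xing c23 s2 s3 t2 t3 p' q', xing c13 s1 s3 t1 p' b3 r', xing c12 s1 s2 r' q' b2 b1#}"

text \<open>\<open>colored_step K f K' f'\<close>: the diagram \<open>K'\<close> arises from \<open>K\<close> by one step in one direction, and
  \<open>f\<close>, \<open>f'\<close> agree outside the region of the step. The first two rules do not change the underlying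
  planar picture: the edges are renamed, or a marked point is erased, so that the edges \<open>a\<close> and
  \<open>b\<close> on its two sides become one edge.\<close>

inductive colored_step ::
    "'e node multiset \<Rightarrow> ('e \<Rightarrow> 'x) \<Rightarrow> 'e node multiset \<Rightarrow> ('e \<Rightarrow> 'x) \<Rightarrow> bool" where
  rename: "inj_on g (edges K) \<Longrightarrow> (\<And>e. e \<in> edges K \<Longrightarrow> f' (g e) = f e) \<Longrightarrow>
    colored_step K f (image_mset (map_node g) K) f'"
| erase_point: "a \<noteq> b \<Longrightarrow> K' = image_mset (map_node (\<lambda>e. if e = b then a else e)) K \<Longrightarrow>
    (\<And>e. e \<in> edges K' \<Longrightarrow> f' e = f e) \<Longrightarrow>
    colored_step (add_mset (Pt a b) K) f K' f'"
| move: "reidemeister T M T' \<Longrightarrow> (\<And>e. e \<in> M \<union> edges N \<Longrightarrow> f' e = f e) \<Longrightarrow>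
    colored_step (T + N) f (T' + N) f'"

definition colored_move ::
    "'e node multiset \<Rightarrow> ('e \<Rightarrow> 'x) \<Rightarrow> 'e node multiset \<Rightarrow> ('e \<Rightarrow> 'x) \<Rightarrow> bool" where
  "colored_move K f K' f' \<longleftrightarrow> colored_step K f K' f' \<or> colored_step K' f' K f"

end

theory Submission
  imports Defs
begin

text \<open>Virtual crossings, marked points and replaced crossings merely identify edges, so a state sum is
  evaluated by collecting such identifications \<open>r\<close>: the bracket of a list of nodes relative to
  \<open>r\<close> expands one node at a time and finally counts the connected components of \<open>r\<close>. An inner edge of a
  local picture has two neighbours and can be contracted, so a local picture amounts to a
  linear combination of pairings of its ends. Axioms (i) and (ii) are the resulting identities for the
  moves I and II, and the 15 equations (iii) belong to the 15 pairings of six ends, for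
  a single version of the classical move III: all strands directed downward, all crossings positive.

  The other 47 versions follow from this one by two operations. Rotating the picture by 60 degrees permutes the
  three strands cyclically and reverses one of them. Exchanging two neighbouring strands by means of II-moves at
  the top and at the bottom permutes the strands without changing their heights and directions. Together these
  operations permute the strands and reverse them arbitrarily.\<close>

section \<open>Counting components\<close>

text \<open>The outside of a move acts on a state only through the identifications \<open>r\<close>,
  which may join ends of the region; two ends may even be the same edge. Each local identity is
  therefore proved for every finite \<open>r\<close>, with freshness demanded of the inner edges
  alone, and the codes before and after the step supply this freshness. On the level of brackets
  crossings can thus be inserted without constructing intermediate diagrams.

  The equations (iii) form a colored Yang-Baxter equation R12 R13 R23 = R23 R13 R12, compared on the
  5 * 3 * 1 perfect matchings of six ends. By (ii), R12 is invertible, and multiplying with its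
  inverse from both sides gives R13 R23 and R23 R13 in the roles that exchange strands 1 and 2. The
  48 versions are the 8 choices of directions times the 6 linear orders of the strands by
  height.\<close>

definition linked :: "('v \<times> 'v) set \<Rightarrow> ('v \<times> 'v) set" where
  "linked r = (r \<union> r\<inverse>)\<^sup>*"

lemma linked_refl [simp]: "(x, x) \<in> linked r"
  by (simp add: linked_def)

lemma linked_sym: "(x, y) \<in> linked r \<Longrightarrow> (y, x) \<in> linked r"
  unfolding linked_def by (meson sym_Un_converse sym_rtrancl symD)

lemma linked_trans: "(x, y) \<in> linked r \<Longrightarrow> (y, z) \<in> linked r \<Longrightarrow> (x, z) \<in> linked r"
  unfolding linked_def by (rule rtrancl_trans)

lemma linked_step: "(x, y) \<in> r \<Longrightarrow> (x, y) \<in> linked r"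
  unfolding linked_def by blast

text \<open>The equivalence closure is the least one; allowing a map \<open>g\<close> in the
  conclusion covers renamings as well as contractions.\<close>

lemma linked_minimal:
  assumes "\<And>x y. (x, y) \<in> r \<Longrightarrow> (g x, g y) \<in> linked s" and "(x, y) \<in> linked r"
  shows "(g x, g y) \<in> linked s"
  using assms(2) unfolding linked_def
proof (induction rule: rtrancl_induct)
  case (step y z)
  then have "(g y, g z) \<in> linked s"
    using assms(1) linked_sym by fast
  then show ?case
    using step.IH unfolding linked_def by (meson rtrancl_trans)
qed simp

lemma linked_map: "(x, y) \<in> linked r \<Longrightarrow> (g x, g y) \<in> linked (map_prod g g ` r)"
  by (erule linked_minimal[rotated]) (auto intro!: linked_step)

lemma linked_class_eq_iff: "linked r `` {x} = linked r `` {y} \<longleftrightarrow> (x, y) \<in> linked r"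
proof
  assume "linked r `` {x} = linked r `` {y}"
  then have "y \<in> linked r `` {x}"
    by simp
  then show "(x, y) \<in> linked r"
    by simp
next
  assume "(x, y) \<in> linked r"
  then show "linked r `` {x} = linked r `` {y}"
    by (blast intro: linked_sym linked_trans)
qed

text \<open>The vertex set need not be carried along: a node joins all of its edges
  (\<open>Field_joins\<close>), and a circle without crossings survives as a pair
  \<open>(a, a)\<close>.\<close>

definition curves :: "('v \<times> 'v) set \<Rightarrow> nat" where
  "curves r = components (Field r) r"

lemma curves_alt: "curves r = card ((\<lambda>x. linked r `` {x}) ` Field r)"
proof -
  have "Field r // linked r = (\<lambda>x. linked r `` {x}) ` Field r"
    by (auto simp: quotient_def)
  then show ?thesis
    by (simp add: curves_def components_def linked_def)
qed

lemma card_image_eq_if_same_kernel: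
  assumes "\<And>x y. x \<in> M \<Longrightarrow> y \<in> M \<Longrightarrow> h x = h y \<longleftrightarrow> k x = k y"
  shows "card (h ` M) = card (k ` M)"
proof (rule bij_betw_same_card)
  have eq: "k (inv_into M h (h x)) = k x" if "x \<in> M" for x
    using assms that by (metis f_inv_into_f imageI inv_into_into)
  then show "bij_betw (\<lambda>c. k (inv_into M h c)) (h ` M) (k ` M)"
    using assms unfolding bij_betw_def inj_on_def by (auto simp: image_image)
qed

lemma curves_eqI:
  assumes "Field r' = g ` Field r"
    and "\<And>x y. x \<in> Field r \<Longrightarrow> y \<in> Field r \<Longrightarrow> (x, y) \<in> linked r \<longleftrightarrow> (g x, g y) \<in> linked r'"
  shows "curves r = curves r'"
  unfolding curves_alt assms(1) image_image
  by (rule card_image_eq_if_same_kernel) (simp add: linked_class_eq_iff assms(2))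

lemma Field_map_prod: "Field (map_prod g g ` r) = g ` Field r"
  by (force simp: Field_def)

lemma curves_rename:
  assumes "inj_on g (Field r)"
  shows "curves (map_prod g g ` r) = curves r"
proof (rule sym, rule curves_eqI[OF Field_map_prod])
  fix x y assume xy: "x \<in> Field r" "y \<in> Field r"
  let ?h = "inv_into (Field r) g"
  have "map_prod ?h ?h ` map_prod g g ` r = (\<lambda>p. p) ` r"
    unfolding image_image
    by (rule image_cong) (auto simp: assms FieldI1 FieldI2 inv_into_f_f)
  then show "(x, y) \<in> linked r \<longleftrightarrow> (g x, g y) \<in> linked (map_prod g g ` r)"
    using linked_map[of x y r g] linked_map[of "g x" "g y" "map_prod g g ` r" ?h] xy assms
    by (auto simp: inv_into_f_f)
qed

text \<open>\<open>g\<close> moves each vertex inside its own component, so it may identify vertices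
  without merging two components.\<close>

lemma curves_retract:
  assumes "\<And>x. (x, g x) \<in> linked r"
  shows "curves (map_prod g g ` r) = curves r"
proof (rule sym, rule curves_eqI[OF Field_map_prod])
  fix x y
  have "(u, v) \<in> linked r" if "(u, v) \<in> linked (map_prod g g ` r)" for u v
  proof -
    have "(g x, g y) \<in> linked r" if "(x, y) \<in> r" for x y
      using assms linked_step[OF that] by (meson linked_sym linked_trans)
    then show ?thesis
      using linked_minimal[of "map_prod g g ` r" id r, OF _ that] by auto
  qed
  then show "(x, y) \<in> linked r \<longleftrightarrow> (g x, g y) \<in> linked (map_prod g g ` r)"
    using linked_map[of x y r g] assms by (meson linked_sym linked_trans)
qed

lemma curves_symmetric_cong: "r \<union> r\<inverse> = s \<union> s\<inverse> \<Longrightarrow> curves r = curves s"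
proof (rule curves_eqI[where g = id])
  assume eq: "r \<union> r\<inverse> = s \<union> s\<inverse>"
  then have "Field (r \<union> r\<inverse>) = Field (s \<union> s\<inverse>)"
    by simp
  then show "Field s = id ` Field r"
    by (simp add: Field_Un)
  show "(x, y) \<in> linked r \<longleftrightarrow> (id x, id y) \<in> linked s" for x y
    using eq by (simp add: linked_def)
qed

lemma linked_insert_refl: "linked (insert (a, a) r) = linked r"
proof -
  have "insert (a, a) r \<union> (insert (a, a) r)\<inverse> = insert (a, a) (r \<union> r\<inverse>)"
    by auto
  then have "linked (insert (a, a) r) = (insert (a, a) (r \<union> r\<inverse>) \<union> Id)\<^sup>*"
    unfolding linked_def by (metis rtrancl_reflcl)
  also have "insert (a, a) (r \<union> r\<inverse>) \<union> Id = (r \<union> r\<inverse>) \<union> Id"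
    by auto
  finally show ?thesis
    unfolding linked_def by (metis rtrancl_reflcl)
qed

lemma curves_absorb: "a \<in> Field r \<Longrightarrow> curves (insert (a, a) r) = curves r"
  unfolding curves_alt by (simp add: linked_insert_refl Field_insert insert_absorb)

lemma linked_isolated: "(p, x) \<in> linked r \<Longrightarrow> p \<notin> Field r \<Longrightarrow> x = p"
  unfolding linked_def by (induction rule: rtrancl_induct) (auto simp: Field_def)

lemma curves_loop:
  assumes "finite r" and "p \<notin> Field r"
  shows "curves (insert (p, p) r) = Suc (curves r)"
proof -
  have "linked r `` {p} \<notin> (\<lambda>x. linked r `` {x}) ` Field r"
    using assms(2) linked_isolated[of p _ r] by (force simp: linked_class_eq_iff)
  moreover have "finite (Field r)"
    using assms(1) by (rule finite_Field)
  ultimately show ?thesis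
    unfolding curves_alt by (simp add: linked_insert_refl Field_insert card_insert_if)
qed

text \<open>The pair \<open>(a, b)\<close> is contracted to \<open>a\<close>. The remaining
  \<open>(a, a)\<close> keeps \<open>a\<close> in the field; for empty \<open>r\<close> it is the
  only trace of the component.\<close>

lemma curves_merge:
  assumes "\<sigma> = (\<lambda>e. if e = b then a else e)"
  shows "curves (insert (a, b) r) = curves (insert (a, a) (map_prod \<sigma> \<sigma> ` r))"
proof -
  have "(x, \<sigma> x) \<in> linked (insert (a, b) r)" for x
    by (auto simp: assms intro: linked_sym linked_step)
  then show ?thesis
    using curves_retract[of \<sigma> "insert (a, b) r"] by (auto simp: assms)
qed

lemma curves_path:
  assumes "p \<notin> Field r" "a \<noteq> p" "b \<noteq> p"
  shows "curves ({(p, a), (p, b)} \<union> r) = curves (insert (a, b) r)"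
proof -
  let ?\<sigma> = "\<lambda>e. if e = p then a else e"
  have "map_prod ?\<sigma> ?\<sigma> ` r = (\<lambda>e. e) ` r"
    by (rule image_cong) (use assms(1) in \<open>auto simp: Field_def\<close>)
  moreover have "curves ({(p, a), (p, b)} \<union> r) = curves (insert (a, p) (insert (p, b) r))"
    by (rule curves_symmetric_cong) auto
  ultimately show ?thesis
    using assms(3) by (simp add: curves_merge[OF refl, of a p] curves_absorb Field_insert)
qed

section \<open>Local pictures\<close>

text \<open>A pair \<open>(p, p)\<close> contributes \<open>p\<close> only once, so a circle through
  \<open>p\<close> alone is recognized by the one-element list \<open>[p]\<close>.\<close>

fun neighbours :: "'l \<Rightarrow> ('l \<times> 'l) list \<Rightarrow> 'l list" where
  "neighbours p [] = []"
| "neighbours p ((a, b) # l) =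
     (if a = p then b # neighbours p l else if b = p then a # neighbours p l else neighbours p l)"

definition avoiding :: "'l \<Rightarrow> ('l \<times> 'l) list \<Rightarrow> ('l \<times> 'l) list" where
  "avoiding p l = filter (\<lambda>(a, b). a \<noteq> p \<and> b \<noteq> p) l"

text \<open>The vertices of a local picture carry concrete labels, so that the simplifier can contract the inner
  vertices \<open>ps\<close> and bring the remaining pairing into a normal form. The first component of the result
  counts the split-off circles. On a list that is not a union of paths and circles at \<open>ps\<close> the function just stops,
  which keeps \<open>curves_resolve\<close> free of side conditions.\<close>

fun resolve :: "'l list \<Rightarrow> ('l \<times> 'l) list \<Rightarrow> nat \<times> ('l \<times> 'l) list" where
  "resolve [] l = (0, l)"
| "resolve (p # ps) l =
     (if neighbours p l = [] then resolve ps l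
      else if neighbours p l = [p] then apfst Suc (resolve ps (avoiding p l))
      else case neighbours p l of
        [a, b] \<Rightarrow> if a \<noteq> p \<and> b \<noteq> p then resolve ps ((a, b) # avoiding p l) else (0, l)
      | _ \<Rightarrow> (0, l))"

text \<open>In a pairing of distinct labels the smaller partners are distinct, so sorting by them
  makes equal pairings syntactically equal and their coefficients can be collected.\<close>

definition normal :: "('l::linorder \<times> 'l) list \<Rightarrow> ('l \<times> 'l) list" where
  "normal l = sort_key fst (map (\<lambda>(a, b). if a \<le> b then (a, b) else (b, a)) l)"

definition picture :: "('l \<Rightarrow> 'e) \<Rightarrow> ('l \<times> 'l) list \<Rightarrow> ('e \<times> 'e) set \<Rightarrow> ('e \<times> 'e) set" where
  "picture \<phi> l r = map_prod \<phi> \<phi> ` set l \<union> r"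

lemma picture_Nil: "picture \<phi> [] r = r"
  by (simp add: picture_def)

lemma neighbours_avoiding:
  "set l \<union> (set l)\<inverse> =
   Pair p ` set (neighbours p l) \<union> set (avoiding p l) \<union>
     (Pair p ` set (neighbours p l) \<union> set (avoiding p l))\<inverse>"
  by (induction p l rule: neighbours.induct) (auto simp: avoiding_def)

lemma picture_cong:
  assumes "set l \<union> (set l)\<inverse> = L \<union> L\<inverse>"
  shows "curves (picture \<phi> l r) = curves (map_prod \<phi> \<phi> ` L \<union> r)"
proof (rule curves_symmetric_cong)
  have conv: "map_prod \<phi> \<phi> ` S \<union> (map_prod \<phi> \<phi> ` S)\<inverse> = map_prod \<phi> \<phi> ` (S \<union> S\<inverse>)" for S
    by force
  have "picture \<phi> l r \<union> (picture \<phi> l r)\<inverse> = map_prod \<phi> \<phi> ` (set l \<union> (set l)\<inverse>) \<union> (r \<union> r\<inverse>)"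
    unfolding picture_def conv[symmetric] by auto
  also have "\<dots> = (map_prod \<phi> \<phi> ` L \<union> r) \<union> (map_prod \<phi> \<phi> ` L \<union> r)\<inverse>"
    unfolding assms conv[symmetric] by auto
  finally show "picture \<phi> l r \<union> (picture \<phi> l r)\<inverse> =
      (map_prod \<phi> \<phi> ` L \<union> r) \<union> (map_prod \<phi> \<phi> ` L \<union> r)\<inverse>" .
qed

lemma Field_avoiding: "Field (set (avoiding p l)) \<subseteq> Field (set l) - {p}"
  by (auto simp: avoiding_def Field_def)

lemma neighbours_in_Field: "set (neighbours p l) \<subseteq> Field (set l)"
  by (induction p l rule: neighbours.induct) (auto simp: Field_insert)

lemma curves_resolve:
  assumes "finite r"
    and "\<And>p. p \<in> set ps \<Longrightarrow> \<phi> p \<notin> Field r"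
    and "\<And>p a. p \<in> set ps \<Longrightarrow> a \<in> Field (set l) \<Longrightarrow> \<phi> a = \<phi> p \<Longrightarrow> a = p"
  shows "curves (picture \<phi> l r) = fst (resolve ps l) + curves (picture \<phi> (snd (resolve ps l)) r)"
  using assms(2,3)
proof (induction ps l rule: resolve.induct)
  case (2 p ps l)
  let ?r = "picture \<phi> (avoiding p l) r"
  have fresh: "\<phi> p \<notin> Field ?r"
    using "2.prems"(1)[of p] "2.prems"(2)[of p] Field_avoiding[of p l]
    by (auto simp: picture_def Field_map_prod)
  have fin: "finite ?r"
    using assms(1) by (simp add: picture_def)
  have split: "curves (picture \<phi> l r) =
      curves (map_prod \<phi> \<phi> ` Pair p ` set (neighbours p l) \<union> ?r)"
    using picture_cong[OF neighbours_avoiding[of l p], of \<phi> r]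
    by (simp add: picture_def image_Un Un_assoc)
  have inner: "\<phi> q \<notin> Field r" if "q \<in> set ps" for q
    using that "2.prems"(1) by simp
  have avoid: "a = q" if "q \<in> set ps" "a \<in> Field (set (avoiding p l))" "\<phi> a = \<phi> q" for q a
    using that "2.prems"(2)[of q a] Field_avoiding[of p l] by auto
  consider "neighbours p l = []" | "neighbours p l = [p]"
    | a b where "neighbours p l = [a, b]" "a \<noteq> p" "b \<noteq> p"
    | "resolve (p # ps) l = (0, l)"
  proof (cases "neighbours p l = [] \<or> neighbours p l = [p] \<or>
      (\<exists>a b. neighbours p l = [a, b] \<and> a \<noteq> p \<and> b \<noteq> p)")
    case False
    then have "resolve (p # ps) l = (0, l)"
      by (auto split: list.split)
    then show ?thesis
      by (rule that)
  qed (use that in blast)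
  then show ?case
  proof cases
    case 1
    then show ?thesis
      using "2.IH"(1) "2.prems" by simp
  next
    case 2
    then have "curves (picture \<phi> l r) = Suc (curves ?r)"
      using curves_loop[OF fin fresh] unfolding split by simp
    moreover have "curves ?r = fst (resolve ps (avoiding p l)) +
        curves (picture \<phi> (snd (resolve ps (avoiding p l))) r)"
      by (rule "2.IH"(2)[OF _ 2]) (use 2 inner avoid in auto)
    ultimately show ?thesis
      using 2 by simp
  next
    case (3 a b)
    let ?l = "(a, b) # avoiding p l"
    have ab: "a \<in> Field (set l)" "b \<in> Field (set l)"
      using neighbours_in_Field[of p l] by (auto simp: 3)
    then have "\<phi> a \<noteq> \<phi> p" "\<phi> b \<noteq> \<phi> p"
      using "2.prems"(2)[of p] 3 by auto
    then have "curves (picture \<phi> l r) = curves (picture \<phi> ?l r)"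
      using curves_path[OF fresh, of "\<phi> a" "\<phi> b"] unfolding split 3 by (simp add: picture_def)
    \<comment> \<open>Contraction creates no vertices: \<open>a\<close> and \<open>b\<close> already
      occur in \<open>l\<close>, so the freshness hypotheses pass to the recursive call.\<close>
    moreover have *: "c = q" if "q \<in> set ps" "c \<in> Field (set ?l)" "\<phi> c = \<phi> q" for q c
      using that ab avoid "2.prems"(2)[of q] by (auto simp: Field_insert)
    moreover have "curves (picture \<phi> ?l r) =
        fst (resolve ps ?l) + curves (picture \<phi> (snd (resolve ps ?l)) r)"
      by (rule "2.IH"(3)[OF _ _ 3(1)]) (use 3 inner * in auto)
    ultimately show ?thesis
      using 3 by simp
  qed simp
qed simp

lemma converse_insert: "(insert (a, b) r)\<inverse> = insert (b, a) (r\<inverse>)"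
  by auto

lemma normal_symmetric: "set l \<union> (set l)\<inverse> = set (normal l) \<union> (set (normal l))\<inverse>"
  unfolding normal_def set_sort set_map
proof (induction l)
  case (Cons p l)
  then show ?case
    by (cases p) (simp add: converse_insert insert_commute)
qed simp

definition reduced :: "'l list \<Rightarrow> ('l::linorder \<times> 'l) list \<Rightarrow> nat \<times> ('l \<times> 'l) list" where
  "reduced ps l = apsnd normal (resolve ps l)"

lemma curves_reduced:
  assumes "finite r"
    and "\<And>p. p \<in> set ps \<Longrightarrow> \<phi> p \<notin> Field r"
    and "\<And>p a. p \<in> set ps \<Longrightarrow> a \<in> Field (set l) \<Longrightarrow> \<phi> a = \<phi> p \<Longrightarrow> a = p"
  shows "curves (picture \<phi> l r) = fst (reduced ps l) + curves (picture \<phi> (snd (reduced ps l)) r)"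
  using curves_resolve[of r ps \<phi> l] assms picture_cong[OF normal_symmetric, of \<phi> "snd (resolve ps l)" r]
  by (simp add: reduced_def picture_def)

section \<open>The bracket of a list of nodes\<close>

text \<open>Opposite to the usual writhe sign, because the exponent of \<open>w\<close> is n -
  p.\<close>

fun sign :: "'e node \<Rightarrow> int" where
  "sign (Cr Positive ul ur ll lr) = - 1"
| "sign (Cr Negative ul ur ll lr) = 1"
| "sign n = 0"

context biquandle_virtual_bracket
begin

text \<open>The last equation lets virtual crossings and marked points take part in the same
  three-term expansion, with a single surviving term.\<close>

fun weight :: "('e \<Rightarrow> 'x) \<Rightarrow> replacement \<Rightarrow> 'e node \<Rightarrow> 'r" where
  "weight f Along (Cr Positive ul ur ll lr) = A (f ul) (f ll)"
| "weight f Against (Cr Positive ul ur ll lr) = B (f ul) (f ll)"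
| "weight f Virtualize (Cr Positive ul ur ll lr) = V (f ul) (f ll)"
| "weight f Along (Cr Negative ul ur ll lr) = C (f ll) (f ul)"
| "weight f Against (Cr Negative ul ur ll lr) = D (f ll) (f ul)"
| "weight f Virtualize (Cr Negative ul ur ll lr) = U (f ll) (f ul)"
| "weight f s n = (if s = Virtualize then 1 else 0)"

fun bracket :: "('e \<Rightarrow> 'x) \<Rightarrow> 'e node list \<Rightarrow> ('e \<times> 'e) set \<Rightarrow> 'r" where
  "bracket f [] r = \<delta> ^ curves r"
| "bracket f (n # ns) r =
     weight f Along n * bracket f ns (joins Along n \<union> r)
   + weight f Against n * bracket f ns (joins Against n \<union> r)
   + weight f Virtualize n * bracket f ns (joins Virtualize n \<union> r)"

end

lemma Field_joins: "Field (joins s n) = set_node n"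
  by (cases "(s, n)" rule: joins.cases) (auto simp: Field_insert)

lemma finite_joins: "finite (joins s n)"
  by (cases "(s, n)" rule: joins.cases) auto

lemma joins_map_node: "joins s (map_node g n) = map_prod g g ` joins s n"
  by (cases "(s, n)" rule: joins.cases) auto

lemma edges_simps [simp]:
  "edges {#} = {}" "edges (add_mset n K) = set_node n \<union> edges K"
  "edges (K + K') = edges K \<union> edges K'"
  by (auto simp: edges_def)

lemma edges_image_mset: "edges (image_mset (map_node g) K) = g ` edges K"
  by (auto simp: edges_def node.set_map)

context biquandle_virtual_bracket
begin

lemma bracket_symmetric_cong:
  "r \<union> r\<inverse> = s \<union> s\<inverse> \<Longrightarrow> bracket f ns r = bracket f ns s"
proof (induction ns arbitrary: r s)
  case Nil
  then have "curves r = curves s"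
    by (rule curves_symmetric_cong)
  then show ?case
    by simp
next
  case (Cons n ns)
  have "bracket f ns (joins t n \<union> r) = bracket f ns (joins t n \<union> s)" for t
    by (rule Cons.IH) (use Cons.prems in blast)
  then show ?case
    by simp
qed

lemma bracket_move: "bracket f (ms @ n # ns) r = bracket f (n # ms @ ns) r"
proof (induction ms arbitrary: r)
  case (Cons m ms)
  have *: "bracket f (ms @ ns) (joins s n \<union> (joins t m \<union> r)) =
      bracket f (ms @ ns) (joins t m \<union> (joins s n \<union> r))" for s t
    by (simp only: Un_left_commute)
  show ?case
    by (simp add: Cons.IH * algebra_simps)
qed simp

lemma bracket_mset_cong: "mset ns = mset ms \<Longrightarrow> bracket f ns r = bracket f ms r"
proof (induction ns arbitrary: ms r)
  case (Cons n ns)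
  then obtain ms1 ms2 where ms: "ms = ms1 @ n # ms2"
    by (metis list.set_intros(1) mset_eq_setD split_list)
  then have "bracket f ns s = bracket f (ms1 @ ms2) s" for s
    using Cons by simp
  then show ?case
    by (simp add: ms bracket_move)
qed simp

text \<open>Expanding the outer nodes first produces the same weights and the same identifications
  on both sides, so an identity of the local parts for all \<open>r\<close> on outer edges is
  enough. The factors \<open>c\<close> and \<open>c'\<close> make room for powers of
  \<open>w\<close>.\<close>

lemma bracket_local:
  assumes "\<And>r. finite r \<Longrightarrow> Field r \<subseteq> E \<Longrightarrow> bracket f T r * c = bracket f' T' r * c'"
    and "edges (mset ns) \<subseteq> E" and "\<And>e. e \<in> edges (mset ns) \<Longrightarrow> f e = f' e"
    and "finite r" and "Field r \<subseteq> E"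
  shows "bracket f (ns @ T) r * c = bracket f' (ns @ T') r * c'"
  using assms(2-)
proof (induction ns arbitrary: r)
  case (Cons n ns)
  have "weight f s n = weight f' s n" for s
    using Cons.prems(2) by (cases "(f, s, n)" rule: weight.cases) auto
  moreover have "bracket f (ns @ T) (joins s n \<union> r) * c =
      bracket f' (ns @ T') (joins s n \<union> r) * c'" for s
    by (rule Cons.IH) (use Cons.prems in \<open>auto simp: Field_joins finite_joins\<close>)
  ultimately show ?case
    by (simp add: distrib_right mult.assoc)
qed (use assms(1) in simp)

text \<open>One induction for injective renamings and for contractions: \<open>u\<close> collects
  the joins of the nodes already expanded, and \<open>g\<close> only has to preserve weights and
  final curve counts.\<close>

lemma bracket_map:
  assumes curves: "\<And>u. Field u \<subseteq> E \<Longrightarrow> curves (u \<union> r) = curves (map_prod g g ` u \<union> r')"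
    and "\<And>e. e \<in> edges (mset ns) \<Longrightarrow> f' (g e) = f e"
    and "edges (mset ns) \<subseteq> E" and "Field u \<subseteq> E"
  shows "bracket f ns (u \<union> r) = bracket f' (map (map_node g) ns) (map_prod g g ` u \<union> r')"
  using assms(2-)
proof (induction ns arbitrary: u)
  case (Cons n ns)
  have "weight f s n = weight f' s (map_node g n)" for s
    using Cons.prems(1) by (cases "(f, s, n)" rule: weight.cases) auto
  moreover have "bracket f ns (joins s n \<union> (u \<union> r)) =
      bracket f' (map (map_node g) ns) (joins s (map_node g n) \<union> (map_prod g g ` u \<union> r'))" for s
    using Cons.IH[of "joins s n \<union> u"] Cons.prems
    by (simp add: Field_joins joins_map_node image_Un Un_assoc)
  ultimately show ?case
    by simp
qed (simp add: curves)

lemma bracket_rename: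
  assumes "inj_on g (edges (mset ns) \<union> Field r)"
    and "\<And>e. e \<in> edges (mset ns) \<Longrightarrow> f' (g e) = f e"
  shows "bracket f ns r = bracket f' (map (map_node g) ns) (map_prod g g ` r)"
  using bracket_map[of "edges (mset ns) \<union> Field r" "{}" g "{}" ns f' f r] assms
  by (auto simp: curves_rename inj_on_subset)

lemma bracket_absorb:
  assumes "a \<in> edges (mset ns) \<union> Field r"
  shows "bracket f ns (insert (a, a) r) = bracket f ns r"
  using assms
proof (induction ns arbitrary: r)
  case (Cons n ns)
  have "bracket f ns (joins s n \<union> insert (a, a) r) = bracket f ns (joins s n \<union> r)" for s
    using Cons.IH[of "joins s n \<union> r"] Cons.prems by (auto simp: Field_joins)
  then show ?case
    by simp
qed (simp add: curves_absorb)

text \<open>This is the erasure of a marked point. The membership assumption on \<open>a\<close>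
  ensures that dropping the pair loses no component: something else still passes through
  \<open>a\<close>.\<close>

lemma bracket_merge:
  assumes "f a = f b" and "\<sigma> = (\<lambda>e. if e = b then a else e)"
    and "a \<in> \<sigma> ` edges (mset ns) \<union> Field r" and "b \<notin> Field r"
  shows "bracket f ns (insert (a, b) r) = bracket f (map (map_node \<sigma>) ns) r"
proof -
  have "map_prod \<sigma> \<sigma> ` r = (\<lambda>e. e) ` r"
    by (rule image_cong) (use assms(2,4) in \<open>auto simp: Field_def\<close>)
  moreover have "bracket f ns ({} \<union> insert (a, b) r) =
      bracket f (map (map_node \<sigma>) ns) (map_prod \<sigma> \<sigma> ` {} \<union> insert (a, a) (map_prod \<sigma> \<sigma> ` r))"
    by (rule bracket_map[where E = UNIV])
      (use assms(1) in \<open>auto simp: assms(2) curves_merge[OF assms(2)] image_Un\<close>)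
  ultimately show ?thesis
    using assms(3) by (simp add: bracket_absorb edges_image_mset)
qed

end

section \<open>The bracket computes the state sum\<close>

lemma UNIV_replacement: "UNIV = {Along, Against, Virtualize}"
  using replacement.exhaust by blast

lemma crossings_add_mset:
  "crossings k (add_mset n K) = (if \<exists>ul ur ll lr. n = Cr k ul ur ll lr then {n} else {}) \<union> crossings k K"
  by (auto simp: crossings_def)

lemma finite_crossings: "finite (crossings k K)"
  by (rule finite_subset[of _ "set_mset K"]) (auto simp: crossings_def)

lemma crossings_subset: "crossings k K \<subseteq> set_mset K"
  by (auto simp: crossings_def)

lemma sum_sign:
  "distinct ns \<Longrightarrow> sum_list (map sign ns) =
     int (card (crossings Negative (mset ns))) - int (card (crossings Positive (mset ns)))"
proof (induction ns)
  case (Cons n ns)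
  then have "n \<notin> crossings k (mset ns)" for k
    using crossings_subset by fastforce
  then show ?case
    using Cons by (cases n rule: sign.cases) (auto simp: crossings_add_mset finite_crossings)
qed (simp add: crossings_def)

lemma classical_subset: "classical K \<subseteq> set_mset K"
  by (simp add: classical_def crossings_subset)

lemma finite_classical: "finite (classical K)"
  by (simp add: classical_def finite_crossings)

lemma sum_PiE_insert:
  assumes "finite M" and "n \<notin> M"
  shows "(\<Sum>S\<in>insert n M \<rightarrow>\<^sub>E UNIV. h S) = (\<Sum>s\<in>UNIV. \<Sum>S\<in>M \<rightarrow>\<^sub>E UNIV. h (S(n := s)))"
  unfolding PiE_insert_eq
  by (subst sum.reindex[OF inj_combinator[OF assms(2)]])
    (simp add: sum.cartesian_product case_prod_unfold)

context biquandle_virtual_bracket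
begin

text \<open>Peeling off one classical node splits the function space of states into three copies.
  Distinctness matters because the product ranges over a set of crossings, the bracket over a
  list.\<close>

lemma bracket_eq_sum:
  assumes "distinct ns"
  shows "(\<Sum>S\<in>classical (mset ns) \<rightarrow>\<^sub>E UNIV.
       (\<Prod>n\<in>classical (mset ns). coefficient A B C D U V f (S n) n) *
         \<delta> ^ curves ((\<Union>n\<in>set ns. joins (S n) n) \<union> r)) = bracket f ns r"
  using assms
proof (induction ns arbitrary: r)
  case Nil
  then show ?case
    by (simp add: classical_def crossings_def)
next
  case (Cons n ns)
  let ?M = "classical (mset ns)"
  have n: "n \<notin> ?M"
    using Cons.prems classical_subset[of "mset ns"] by auto
  show ?case
  proof (cases "n \<in> classical {#n#}")
    case True
    then have M: "classical (mset (n # ns)) = insert n ?M"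
      by (auto simp: classical_def crossings_def)
    have coefficient: "coefficient A B C D U V f s n = weight f s n" for s
      using True by (cases "(f, s, n)" rule: weight.cases)
        (auto simp: coefficient_def classical_def crossings_def)
    have "(\<Sum>S\<in>?M \<rightarrow>\<^sub>E UNIV.
        (\<Prod>m\<in>insert n ?M. coefficient A B C D U V f ((S(n := s)) m) m) *
          \<delta> ^ curves ((\<Union>m\<in>set (n # ns). joins ((S(n := s)) m) m) \<union> r)) =
        weight f s n * bracket f ns (joins s n \<union> r)" for s
    proof -
      have "(\<Prod>m\<in>insert n ?M. coefficient A B C D U V f ((S(n := s)) m) m) =
          weight f s n * (\<Prod>m\<in>?M. coefficient A B C D U V f (S m) m)" for S
        using n by (simp add: finite_classical coefficient)
          (intro arg_cong2[where f = "(*)"] prod.cong, auto)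
      moreover have "(\<Union>m\<in>set (n # ns). joins ((S(n := s)) m) m) \<union> r =
          (\<Union>m\<in>set ns. joins (S m) m) \<union> (joins s n \<union> r)" for S
      proof -
        have "(\<Union>m\<in>set ns. joins ((S(n := s)) m) m) = (\<Union>m\<in>set ns. joins (S m) m)"
          by (rule SUP_cong) (use Cons.prems in auto)
        then show ?thesis
          by (simp add: Un_ac)
      qed
      ultimately show ?thesis
        using Cons by (simp add: sum_distrib_left[symmetric] mult.assoc)
    qed
    then show ?thesis
      unfolding M sum_PiE_insert[OF finite_classical n] by (simp add: UNIV_replacement add.assoc)
  next
    case False
    then have M: "classical (mset (n # ns)) = ?M"
      by (auto simp: classical_def crossings_def)
    \<comment> \<open>A state is \<open>undefined\<close> at nonclassical nodes; the value is
      irrelevant since all replacements join the same edges there.\<close>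
    have joins: "joins s n = joins Virtualize n"
      and weight: "weight f s n = (if s = Virtualize then 1 else 0)" for s
      using False by (cases "(f, s, n)" rule: weight.cases; auto simp: classical_def crossings_def)+
    have "(\<Union>m\<in>set (n # ns). joins (S m) m) \<union> r =
        (\<Union>m\<in>set ns. joins (S m) m) \<union> (joins Virtualize n \<union> r)" for S
      using joins[of "S n"] by (simp add: Un_ac)
    then show ?thesis
      unfolding M using Cons by (simp add: weight)
  qed
qed

lemma state_sum_eq_bracket:
  assumes "distinct ns"
  shows "state_sum A B C D U V \<delta> w (mset ns) f = bracket f ns {} * unit_powi w (sum_list (map sign ns))"
proof -
  have "closed_curves (mset ns) S = curves (\<Union>n\<in>set ns. joins (S n) n)" for S
  proof -
    have "Field (\<Union>n\<in>set ns. joins (S n) n) = edges (mset ns)"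
      by (simp add: Field_Union Field_joins edges_def image_image)
    then show ?thesis
      by (simp add: closed_curves_def curves_def)
  qed
  then show ?thesis
    unfolding state_sum_def sum_sign[OF assms] bracket_eq_sum[OF assms, of f "{}", symmetric]
    by (simp add: sum_distrib_right)
qed

end

section \<open>Integer powers of the unit \<open>w\<close>\<close>

lemma unit_inv:
  assumes "u dvd (1 :: 'a::comm_ring_1)"
  shows "u * unit_inv u = 1"
proof -
  obtain v where v: "u * v = 1"
    using assms by (metis dvd_def)
  have "v' = v" if "u * v' = 1" for v'
    using that v by (metis mult.assoc mult.commute mult.right_neutral)
  with v show ?thesis
    unfolding unit_inv_def by (metis (mono_tags, lifting) theI)
qed

lemma unit_powi_add:
  assumes "w dvd (1 :: 'a::comm_ring_1)"
  shows "unit_powi w (a + b) = unit_powi w a * unit_powi w b"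
proof -
  have succ: "unit_powi w (k + 1) = unit_powi w k * w" for k
  proof (cases "k \<ge> 0")
    case True
    then show ?thesis
      by (simp add: unit_powi_def nat_add_distrib mult.commute)
  next
    case False
    then have "nat (- k) = Suc (nat (- (k + 1)))"
      by simp
    moreover have cancel: "w * (unit_inv w * c) = c" for c
      by (simp add: mult.assoc[symmetric] unit_inv[OF assms])
    ultimately show ?thesis
      using False unit_inv[OF assms] by (simp add: unit_powi_def mult.commute[of _ w] cancel)
  qed
  have pred: "unit_powi w (k - 1) = unit_powi w k * unit_inv w" for k
    using succ[of "k - 1"] unit_inv[OF assms] by (simp add: mult.assoc)
  show ?thesis
  proof (induction b rule: int_induct[where k = 0])
    case base
    then show ?case
      by (simp add: unit_powi_def)
  next
    case (step1 i)
    then show ?case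
      using succ[of "a + i"] succ[of i] by (simp add: algebra_simps)
  next
    case (step2 i)
    then show ?case
      using pred[of "a + i"] pred[of i] by (simp add: algebra_simps)
  qed
qed

section \<open>Evaluation of the local pictures\<close>

text \<open>The images under \<open>\<phi>\<close> of the inner vertices \<open>ps\<close> are new; the other vertices may coincide, since
  different ends of a local picture may belong to the same edge.\<close>

definition inner :: "(nat \<Rightarrow> 'e) \<Rightarrow> nat \<Rightarrow> nat list \<Rightarrow> ('e \<times> 'e) set \<Rightarrow> bool" where
  "inner \<phi> m ps r \<longleftrightarrow> finite r \<and> (\<forall>p\<in>set ps. \<phi> p \<notin> Field r \<and> (\<forall>a<m. \<phi> a = \<phi> p \<longrightarrow> a = p))"

context biquandle_virtual_bracket
begin

text \<open>The contribution of one pairing of the ends, kept opaque so that pictures become formal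
  linear combinations and are compared coefficient by coefficient.\<close>

definition loops :: "(nat \<Rightarrow> 'e) \<Rightarrow> ('e \<times> 'e) set \<Rightarrow> (nat \<times> nat) list \<Rightarrow> 'r" where
  "loops \<phi> r l = \<delta> ^ curves (picture \<phi> l r)"

lemma bracket_Nil_picture:
  assumes "inner \<phi> m ps r" and "list_all (\<lambda>(a, b). a < m \<and> b < m) l"
  shows "bracket f [] (picture \<phi> l r) = \<delta> ^ fst (reduced ps l) * loops \<phi> r (snd (reduced ps l))"
proof -
  have "Field (set l) \<subseteq> {..<m}"
    using assms(2) by (auto simp: Field_def list_all_iff)
  then have "curves (picture \<phi> l r) = fst (reduced ps l) + curves (picture \<phi> (snd (reduced ps l)) r)"
    using assms(1) by (intro curves_reduced) (auto simp: inner_def)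
  then show ?thesis
    by (simp add: loops_def power_add)
qed

text \<open>Without orientation the smoothings are a vertical and a horizontal one; the vertical one
  respects orientation exactly if the two strand directions agree.\<close>

lemma joins_xing:
  fixes c s s' and nw ne sw se :: 'e
  defines "X \<equiv> xing c s s' nw ne sw se"
  shows "joins (if s = s' then Along else Against) X \<union> (joins (if s = s' then Along else Against) X)\<inverse> =
      (if c = NoneOver then {(nw, se), (ne, sw)} \<union> {(nw, se), (ne, sw)}\<inverse>
       else {(nw, sw), (ne, se)} \<union> {(nw, sw), (ne, se)}\<inverse>)"
    and "joins (if s = s' then Against else Along) X \<union> (joins (if s = s' then Against else Along) X)\<inverse> =
      (if c = NoneOver then {(nw, se), (ne, sw)} \<union> {(nw, se), (ne, sw)}\<inverse>
       else {(nw, ne), (sw, se)} \<union> {(nw, ne), (sw, se)}\<inverse>)"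
    and "joins Virtualize X \<union> (joins Virtualize X)\<inverse> =
      {(nw, se), (ne, sw)} \<union> {(nw, se), (ne, sw)}\<inverse>"
  by (cases c; cases s; cases s'; auto simp: X_def xing_def xing_kind_def)+

lemma bracket_xing:
  fixes \<phi> :: "nat \<Rightarrow> 'e"
  defines "X \<equiv> \<lambda>c s s' nw ne sw se. xing c s s' (\<phi> nw) (\<phi> ne) (\<phi> sw) (\<phi> se)"
  shows "bracket f (X c s s' nw ne sw se # ns) (picture \<phi> l r) =
     weight f (if s = s' then Along else Against) (X c s s' nw ne sw se) *
       bracket f ns (picture \<phi> ((nw, sw) # (ne, se) # l) r)
   + weight f (if s = s' then Against else Along) (X c s s' nw ne sw se) *
       bracket f ns (picture \<phi> ((nw, ne) # (sw, se) # l) r)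
   + weight f Virtualize (X c s s' nw ne sw se) *
       bracket f ns (picture \<phi> ((nw, se) # (ne, sw) # l) r)"
proof -
  let ?X = "X c s s' nw ne sw se"
  let ?s = "if s = s' then Along else Against" and ?s' = "if s = s' then Against else Along"
  have sym: "bracket f ns (j \<union> picture \<phi> l r) = bracket f ns (picture \<phi> (l' @ l) r)"
    if "j \<union> j\<inverse> = map_prod \<phi> \<phi> ` set l' \<union> (map_prod \<phi> \<phi> ` set l')\<inverse>" for j l'
  proof (rule bracket_symmetric_cong)
    have "(j \<union> picture \<phi> l r) \<union> (j \<union> picture \<phi> l r)\<inverse> = (j \<union> j\<inverse>) \<union> (picture \<phi> l r \<union> (picture \<phi> l r)\<inverse>)"
      by auto
    then show "(j \<union> picture \<phi> l r) \<union> (j \<union> picture \<phi> l r)\<inverse> =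
        picture \<phi> (l' @ l) r \<union> (picture \<phi> (l' @ l) r)\<inverse>"
      unfolding that by (auto simp: picture_def)
  qed
  have 3: "bracket f ns (joins Virtualize ?X \<union> picture \<phi> l r) =
      bracket f ns (picture \<phi> ([(nw, se), (ne, sw)] @ l) r)"
    by (rule sym) (simp add: X_def joins_xing)
  \<comment> \<open>At a virtual crossing \<open>joins\<close> yields the crossed pairing for every
    replacement; the smoothing terms are then correct because their weights vanish.\<close>
  have 1: "weight f ?s ?X = 0 \<or>
      bracket f ns (joins ?s ?X \<union> picture \<phi> l r) = bracket f ns (picture \<phi> ([(nw, sw), (ne, se)] @ l) r)"
  proof (cases "c = NoneOver")
    case False
    then show ?thesis
      by (intro disjI2 sym) (simp only: X_def joins_xing, simp)
  qed (auto simp: X_def xing_def xing_kind_def)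
  have 2: "weight f ?s' ?X = 0 \<or>
      bracket f ns (joins ?s' ?X \<union> picture \<phi> l r) =
          bracket f ns (picture \<phi> ([(nw, ne), (sw, se)] @ l) r)"
  proof (cases "c = NoneOver")
    case False
    then show ?thesis
      by (intro disjI2 sym) (simp only: X_def joins_xing, simp)
  qed (auto simp: X_def xing_def xing_kind_def)
  have "bracket f (?X # ns) (picture \<phi> l r) =
      weight f ?s ?X * bracket f ns (joins ?s ?X \<union> picture \<phi> l r) +
      weight f ?s' ?X * bracket f ns (joins ?s' ?X \<union> picture \<phi> l r) +
      weight f Virtualize ?X * bracket f ns (joins Virtualize ?X \<union> picture \<phi> l r)"
    by (simp add: add.commute)
  then show ?thesis
    using 1 2 3 by auto
qed

lemma bracket_positive:
  fixes \<phi> :: "nat \<Rightarrow> 'e"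
  shows "bracket f (Cr Positive (\<phi> nw) (\<phi> ne) (\<phi> sw) (\<phi> se) # ns) (picture \<phi> l r) =
     A (f (\<phi> nw)) (f (\<phi> sw)) * bracket f ns (picture \<phi> ((nw, sw) # (ne, se) # l) r)
   + B (f (\<phi> nw)) (f (\<phi> sw)) * bracket f ns (picture \<phi> ((nw, ne) # (sw, se) # l) r)
   + V (f (\<phi> nw)) (f (\<phi> sw)) * bracket f ns (picture \<phi> ((nw, se) # (ne, sw) # l) r)"
  using bracket_xing[of f SecondOver True True \<phi> nw ne sw se] by (simp add: xing_def xing_kind_def)

lemma bracket_virtual:
  fixes \<phi> :: "nat \<Rightarrow> 'e"
  shows "bracket f (xing NoneOver s s' (\<phi> nw) (\<phi> ne) (\<phi> sw) (\<phi> se) # ns) (picture \<phi> l r) =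
    bracket f ns (picture \<phi> ((nw, se) # (ne, sw) # l) r)"
  unfolding bracket_xing by (simp add: xing_def xing_kind_def)

lemmas reduced_simps = reduced_def normal_def avoiding_def

text \<open>Both entries of the color pair of a kink are the color of \<open>e\<close>, or they are
  the equal colors of \<open>t\<close> and \<open>b\<close>; hence axiom (i) applies. Both strands
  of a kink have direction \<open>s\<close>, so \<open>Along\<close> is what splits off the
  circle.\<close>

lemma reidemeister_I_weights:
  assumes "X = xing c s s e t e b \<or> X = xing c s s t e b e" and "f t = f b"
  shows "(\<delta> * weight f Along X + weight f Against X + weight f Virtualize X) * unit_powi w (sign X) = 1"
proof -
  have "unit_inv w * w = 1"
    using unit_inv[OF w_unit] by (simp add: mult.commute)
  then show ?thesis
    using assms unit_inv[OF w_unit] w w_inv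
    by (cases c; cases s; auto simp: xing_def xing_kind_def unit_powi_def)
qed

lemma reidemeister_I_picture:
  fixes \<phi> :: "nat \<Rightarrow> 'e"
  assumes "inner \<phi> 3 [2] r" and "f (\<phi> 0) = f (\<phi> 1)"
    and "X = xing c s s (\<phi> 2) (\<phi> 0) (\<phi> 2) (\<phi> 1) \<or> X = xing c s s (\<phi> 0) (\<phi> 2) (\<phi> 1) (\<phi> 2)"
  shows "bracket f [X] (picture \<phi> [] r) * unit_powi w (sign X) = loops \<phi> r [(0, 1)]"
proof -
  have "bracket f [X] (picture \<phi> [] r) =
      (\<delta> * weight f Along X + weight f Against X + weight f Virtualize X) * loops \<phi> r [(0, 1)]"
    using assms(3)
    by (elim disjE; simp only: bracket_xing)
      (simp_all add: bracket_Nil_picture[OF assms(1)] reduced_simps algebra_simps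
        del: bracket.simps One_nat_def)
  then have "bracket f [X] (picture \<phi> [] r) * unit_powi w (sign X) =
      ((\<delta> * weight f Along X + weight f Against X + weight f Virtualize X) * unit_powi w (sign X)) *
        loops \<phi> r [(0, 1)]"
    by (simp only: mult.assoc mult.commute mult.left_commute)
  then show ?thesis
    unfolding reidemeister_I_weights[of X c s "\<phi> 2" "\<phi> 0" "\<phi> 1" f, OF assms(3,2)]
    by simp
qed

text \<open>\<open>v\<close>, \<open>h\<close>, \<open>x\<close> stand for vertical, horizontal and
  crossed. Classical crossings of a II-move have opposite signs and the same color pair. The last
  identity adds the fifth or sixth equation of (ii) to the fourth or third, according to whether
  \<open>h\<close> means \<open>Against\<close> or \<open>Along\<close>.\<close>

lemma reidemeister_II_weights:
  fixes f c s1 s2 and t1 t2 p q b1 b2 :: 'e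
  defines "X \<equiv> xing c s1 s2 t1 t2 p q" and "Y \<equiv> xing (swap c) s2 s1 p q b1 b2"
  defines "v \<equiv> weight f (if s1 = s2 then Along else Against)"
    and "h \<equiv> weight f (if s1 = s2 then Against else Along)"
    and "x \<equiv> weight f Virtualize"
  assumes "f t1 = f b1" and "f t2 = f b2"
  shows "v X * v Y + x X * x Y = 1" and "v X * x Y + x X * v Y = 0"
    and "\<delta> * h X * h Y + v X * h Y + h X * v Y + h X * x Y + x X * h Y = 0"
proof -
  note ii = ii1[symmetric] ii2[symmetric] ii3[symmetric] ii4[symmetric] ii5[symmetric] ii6[symmetric]
  have 1: "C y z * A y z + U y z * V y z = 1" "D y z * B y z + U y z * V y z = 1"
    "U y z * A y z + C y z * V y z = 0" "C y z * V y z + U y z * A y z = 0"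
    "B y z * U y z + V y z * D y z = 0"
     "D y z * V y z + U y z * B y z = 0" for y z
    using ii by (simp_all add: mult.commute add.commute)
  have 2: "\<delta> * B y z * D y z + A y z * D y z + B y z * C y z + B y z * U y z + V y z * D y z = 0"
   "\<delta> * A y z * C y z + A y z * D y z + B y z * C y z + A y z * U y z + V y z * C y z = 0" for y z
    using ii by (simp_all add: add.assoc)
  show "v X * v Y + x X * x Y = 1" "v X * x Y + x X * v Y = 0"
    "\<delta> * h X * h Y + v X * h Y + h X * v Y + h X * x Y + x X * h Y = 0"
    using 1 2 ii assms(6,7)
    by (cases c; cases s1; cases s2; simp add: X_def Y_def v_def h_def x_def xing_def xing_kind_def;
      (simp add: algebra_simps)?)+
qed

text \<open>The nine states yield the three pairings of four ends; only the one joining each top to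
  its own bottom keeps a nonzero coefficient.\<close>

lemma reidemeister_II_picture:
  fixes \<phi> :: "nat \<Rightarrow> 'e"
  assumes "inner \<phi> 6 [4, 5] r" and "f (\<phi> 0) = f (\<phi> 1)" and "f (\<phi> 2) = f (\<phi> 3)"
  shows "bracket f [xing c s1 s2 (\<phi> 0) (\<phi> 2) (\<phi> 4) (\<phi> 5), xing (swap c) s2 s1 (\<phi> 4) (\<phi> 5) (\<phi> 1) (\<phi> 3)]
    (picture \<phi> [] r) = loops \<phi> r [(0, 1), (2, 3)]"
proof -
  let ?X = "xing c s1 s2 (\<phi> 0) (\<phi> 2) (\<phi> 4) (\<phi> 5)"
  let ?Y = "xing (swap c) s2 s1 (\<phi> 4) (\<phi> 5) (\<phi> 1) (\<phi> 3)"
  \<comment> \<open>These abbreviations hide the conditionals on the directions from the simplifier;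
    \<open>vh\<close> treats the second crossing, which lists the directions in the other
    order.\<close>
  define v h x where vhx: "v = (\<lambda>n. weight f (if s1 = s2 then Along else Against) n)"
    "h = (\<lambda>n. weight f (if s1 = s2 then Against else Along) n)" "x = (\<lambda>n. weight f Virtualize n)"
  then have vh: "(\<lambda>n. weight f (if s2 = s1 then Along else Against) n) = v"
    "(\<lambda>n. weight f (if s2 = s1 then Against else Along) n) = h"
    by (simp_all add: eq_commute)
  note fold = vhx[THEN fun_cong, symmetric] vh[THEN fun_cong]
  have "bracket f [?X, ?Y] (picture \<phi> [] r) =
      (v ?X * v ?Y + x ?X * x ?Y) * loops \<phi> r [(0, 1), (2, 3)]
    + (v ?X * x ?Y + x ?X * v ?Y) * loops \<phi> r [(0, 3), (1, 2)]
    + (\<delta> * h ?X * h ?Y + v ?X * h ?Y + h ?X * v ?Y + h ?X * x ?Y + x ?X * h ?Y) *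
        loops \<phi> r [(0, 2), (1, 3)]"
    unfolding bracket_xing fold
    by (simp add: bracket_Nil_picture[OF assms(1)] reduced_simps algebra_simps
        del: bracket.simps One_nat_def)
  then show ?thesis
    using reidemeister_II_weights[of f "\<phi> 0" "\<phi> 1" "\<phi> 2" "\<phi> 3" s1 s2 c "\<phi> 4" "\<phi> 5"] assms(2,3)
    by (simp add: vhx)
qed

text \<open>The ends \<open>t\<^sub>1, t\<^sub>2, t\<^sub>3, b\<^sub>1, b\<^sub>2, b\<^sub>3\<close> of the move III have the labels 0 to 5, the inner edges of its two sides
  the labels 6 to 8 and 9 to 11. The color pairs \<open>(x, y)\<close> and \<open>(y, z)\<close> of the first and the last crossing on the left
  determine all other colors.\<close>

lemma braid_left_picture:
  fixes f and \<phi> :: "nat \<Rightarrow> 'e"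
  defines "x \<equiv> f (\<phi> 0)" and "y \<equiv> f (\<phi> 6)" and "z \<equiv> f (\<phi> 5)"
  assumes "inner \<phi> 12 [6, 7, 8, 9, 10, 11] r"
    and "f (\<phi> 7) = x \<rhd>\<^sub>u y" and "f (\<phi> 8) = z \<rhd>\<^sub>o y"
  shows "bracket f [Cr Positive (\<phi> 0) (\<phi> 1) (\<phi> 6) (\<phi> 7), Cr Positive (\<phi> 7) (\<phi> 2) (\<phi> 8) (\<phi> 3),
      Cr Positive (\<phi> 6) (\<phi> 8) (\<phi> 5) (\<phi> 4)] (picture \<phi> [] r) =
    loops \<phi> r [(0, 5), (1, 4), (2, 3)] * (lbr A A A x y z + lbr V A V x y z)
    + loops \<phi> r [(0, 1), (2, 3), (4, 5)] * (lbr A A B x y z + lbr B A A x y z + \<delta> * lbr B A B x y z +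
        lbr B A V x y z
        + lbr B B B x y z + lbr B V B x y z + lbr V A B x y z)
    + loops \<phi> r [(0, 5), (1, 2), (3, 4)] * (lbr A B A x y z)
    + loops \<phi> r [(0, 5), (1, 3), (2, 4)] * (lbr A V A x y z)
    + loops \<phi> r [(0, 4), (1, 5), (2, 3)] * (lbr A A V x y z + lbr V A A x y z)
    + loops \<phi> r [(0, 1), (2, 5), (3, 4)] * (lbr B B A x y z + lbr B V V x y z)
    + loops \<phi> r [(0, 3), (1, 2), (4, 5)] * (lbr A B B x y z + lbr V V B x y z)
    + loops \<phi> r [(0, 1), (2, 4), (3, 5)] * (lbr B B V x y z + lbr B V A x y z)
    + loops \<phi> r [(0, 4), (1, 2), (3, 5)] * (lbr A B V x y z)
    + loops \<phi> r [(0, 2), (1, 5), (3, 4)] * (lbr V B A x y z)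
    + loops \<phi> r [(0, 2), (1, 3), (4, 5)] * (lbr A V B x y z + lbr V B B x y z)
    + loops \<phi> r [(0, 3), (1, 5), (2, 4)] * (lbr V V A x y z)
    + loops \<phi> r [(0, 4), (1, 3), (2, 5)] * (lbr A V V x y z)
    + loops \<phi> r [(0, 2), (1, 4), (3, 5)] * (lbr V B V x y z)
    + loops \<phi> r [(0, 3), (1, 4), (2, 5)] * (lbr V V V x y z)"
  using assms
  by (simp add: bracket_positive bracket_Nil_picture[OF assms(4)] reduced_simps lbr_def algebra_simps
      del: bracket.simps One_nat_def)

text \<open>The pairings appear in the same order as for the left-hand side, so equating
  coefficients gives exactly the equations \<open>iii1\<close> to \<open>iii15\<close>.\<close>

lemma braid_right_picture:
  fixes f and \<phi> :: "nat \<Rightarrow> 'e"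
  defines "x \<equiv> f (\<phi> 0)" and "z \<equiv> f (\<phi> 5)"
  assumes "inner \<phi> 12 [6, 7, 8, 9, 10, 11] r"
    and "f (\<phi> 1) = y \<rhd>\<^sub>o x" and "f (\<phi> 9) = z \<rhd>\<^sub>o x" and "f (\<phi> 11) = x \<rhd>\<^sub>u z" and "f (\<phi> 4) = y \<rhd>\<^sub>u z"
  shows "bracket f [Cr Positive (\<phi> 1) (\<phi> 2) (\<phi> 9) (\<phi> 10), Cr Positive (\<phi> 0) (\<phi> 9) (\<phi> 5) (\<phi> 11),
      Cr Positive (\<phi> 11) (\<phi> 10) (\<phi> 4) (\<phi> 3)] (picture \<phi> [] r) =
    loops \<phi> r [(0, 5), (1, 4), (2, 3)] * (rbr A A A x y z + rbr V A V x y z)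
    + loops \<phi> r [(0, 1), (2, 3), (4, 5)] * (rbr A B A x y z)
    + loops \<phi> r [(0, 5), (1, 2), (3, 4)] * (rbr A A B x y z + rbr B A A x y z + \<delta> * rbr B A B x y z +
        rbr B A V x y z
        + rbr B B B x y z + rbr B V B x y z + rbr V A B x y z)
    + loops \<phi> r [(0, 5), (1, 3), (2, 4)] * (rbr A A V x y z + rbr V A A x y z)
    + loops \<phi> r [(0, 4), (1, 5), (2, 3)] * (rbr A V A x y z)
    + loops \<phi> r [(0, 1), (2, 5), (3, 4)] * (rbr A B B x y z + rbr V V B x y z)
    + loops \<phi> r [(0, 3), (1, 2), (4, 5)] * (rbr B B A x y z + rbr B V V x y z)
    + loops \<phi> r [(0, 1), (2, 4), (3, 5)] * (rbr A B V x y z)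
    + loops \<phi> r [(0, 4), (1, 2), (3, 5)] * (rbr B B V x y z + rbr B V A x y z)
    + loops \<phi> r [(0, 2), (1, 5), (3, 4)] * (rbr A V B x y z + rbr V B B x y z)
    + loops \<phi> r [(0, 2), (1, 3), (4, 5)] * (rbr V B A x y z)
    + loops \<phi> r [(0, 3), (1, 5), (2, 4)] * (rbr A V V x y z)
    + loops \<phi> r [(0, 4), (1, 3), (2, 5)] * (rbr V V A x y z)
    + loops \<phi> r [(0, 2), (1, 4), (3, 5)] * (rbr V B V x y z)
    + loops \<phi> r [(0, 3), (1, 4), (2, 5)] * (rbr V V V x y z)"
  using assms
  by (simp add: bracket_positive bracket_Nil_picture[OF assms(3)] reduced_simps rbr_def algebra_simps
      del: bracket.simps One_nat_def)

lemma braid_picture: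
  fixes \<phi> :: "nat \<Rightarrow> 'e"
  assumes "inner \<phi> 12 [6, 7, 8, 9, 10, 11] r"
    and "\<forall>n\<in>{Cr Positive (\<phi> 0) (\<phi> 1) (\<phi> 6) (\<phi> 7), Cr Positive (\<phi> 7) (\<phi> 2) (\<phi> 8) (\<phi> 3),
      Cr Positive (\<phi> 6) (\<phi> 8) (\<phi> 5) (\<phi> 4), Cr Positive (\<phi> 0) (\<phi> 9) (\<phi> 5) (\<phi> 11)}.
      colored_at (\<rhd>\<^sub>u) (\<rhd>\<^sub>o) f n"
  shows "bracket f [Cr Positive (\<phi> 0) (\<phi> 1) (\<phi> 6) (\<phi> 7), Cr Positive (\<phi> 7) (\<phi> 2) (\<phi> 8) (\<phi> 3),
      Cr Positive (\<phi> 6) (\<phi> 8) (\<phi> 5) (\<phi> 4)] (picture \<phi> [] r) =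
    bracket f [Cr Positive (\<phi> 1) (\<phi> 2) (\<phi> 9) (\<phi> 10), Cr Positive (\<phi> 0) (\<phi> 9) (\<phi> 5) (\<phi> 11),
      Cr Positive (\<phi> 11) (\<phi> 10) (\<phi> 4) (\<phi> 3)] (picture \<phi> [] r)"
proof -
  \<comment> \<open>The colors of the shared ends 1 and 4 are read off on the left and express the
    color pairs on the right by the same \<open>x\<close>, \<open>y\<close>,
    \<open>z\<close>.\<close>
  have colors: "f (\<phi> 7) = f (\<phi> 0) \<rhd>\<^sub>u f (\<phi> 6)" "f (\<phi> 8) = f (\<phi> 5) \<rhd>\<^sub>o f (\<phi> 6)"
    "f (\<phi> 1) = f (\<phi> 6) \<rhd>\<^sub>o f (\<phi> 0)" "f (\<phi> 9) = f (\<phi> 5) \<rhd>\<^sub>o f (\<phi> 0)"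
    "f (\<phi> 11) = f (\<phi> 0) \<rhd>\<^sub>u f (\<phi> 5)" "f (\<phi> 4) = f (\<phi> 6) \<rhd>\<^sub>u f (\<phi> 5)"
    using assms(2) by auto
  show ?thesis
    unfolding braid_left_picture[OF assms(1) colors(1,2)] braid_right_picture[OF assms(1) colors(3-6)]
    by (simp only: iii1 iii2 iii3 iii4 iii5 iii6 iii7 iii8 iii9 iii10 iii11 iii12 iii13 iii14 iii15)
qed

text \<open>Virtual crossings transmit labels, so the crossing of strands 1 and 2 has the same
  weights on both sides, and each of its replacements gives the same pairing. With
  \<open>c = NoneOver\<close> this is the purely virtual move.\<close>

lemma mixed_picture:
  fixes \<phi> :: "nat \<Rightarrow> 'e"
  assumes "inner \<phi> 12 [6, 7, 8, 9, 10, 11] r"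
    and "f (\<phi> 6) = f (\<phi> 4)" and "f (\<phi> 7) = f (\<phi> 3)" and "f (\<phi> 11) = f (\<phi> 0)" and "f (\<phi> 10) = f (\<phi> 1)"
  shows "bracket f [xing c s1 s2 (\<phi> 0) (\<phi> 1) (\<phi> 6) (\<phi> 7), xing NoneOver s1 s3 (\<phi> 7) (\<phi> 2) (\<phi> 8) (\<phi> 3),
      xing NoneOver s2 s3 (\<phi> 6) (\<phi> 8) (\<phi> 5) (\<phi> 4)] (picture \<phi> [] r) =
    bracket f [xing NoneOver s2 s3 (\<phi> 1) (\<phi> 2) (\<phi> 9) (\<phi> 10),
        xing NoneOver s1 s3 (\<phi> 0) (\<phi> 9) (\<phi> 5) (\<phi> 11),
      xing c s1 s2 (\<phi> 11) (\<phi> 10) (\<phi> 4) (\<phi> 3)] (picture \<phi> [] r)"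
proof -
  have "weight f s (xing c s1 s2 (\<phi> 11) (\<phi> 10) (\<phi> 4) (\<phi> 3)) =
      weight f s (xing c s1 s2 (\<phi> 0) (\<phi> 1) (\<phi> 6) (\<phi> 7))" for s
    using assms(2-) by (cases c; cases s1; cases s2; cases s; simp add: xing_def xing_kind_def)
  then show ?thesis
    unfolding bracket_virtual unfolding bracket_xing[where c = c] unfolding bracket_virtual
    by (simp add: bracket_Nil_picture[OF assms(1)] reduced_simps del: bracket.simps One_nat_def)
qed

end

section \<open>Reidemeister III for all directions and heights\<close>

text \<open>A quarter turn: the second strand becomes the first, and the lower end of the old first
  strand becomes an upper end, which negates its direction.\<close>

lemma xing_rotate: "xing c s s' nw ne sw se = xing (swap c) s' (\<not> s) ne se nw sw"
  by (cases c; cases s; cases s'; simp add: xing_def xing_kind_def)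

lemma map_node_xing: "map_node g (xing c s s' nw ne sw se) = xing c s s' (g nw) (g ne) (g sw) (g se)"
  by (simp add: xing_def)

lemma set_node_xing: "set_node (xing c s s' nw ne sw se) = {nw, ne, sw, se}"
  by (auto simp: xing_def)

lemma swap_swap [simp]: "swap (swap c) = c"
  by (cases c) auto

text \<open>Reflecting the crossing in a horizontal line and reversing both strands each exchange
  left and right, so together they preserve them; the coloring rule is the same for both
  signs.\<close>

lemma colored_at_flip:
  "colored_at ut ot f (xing (swap c) s2 s1 p q b1 b2) \<longleftrightarrow> colored_at ut ot f (xing c s1 s2 b1 b2 p q)"
  by (cases c; cases s1; cases s2; auto simp: xing_def xing_kind_def)

lemma colored_at_xing_cong:
  assumes "f nw = f nw'" "f ne = f ne'" "f sw = f sw'" "f se = f se'"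
  shows "colored_at ut ot f (xing c s s' nw ne sw se) \<longleftrightarrow> colored_at ut ot f (xing c s s' nw' ne' sw' se')"
  using assms by (cases c; cases s; cases s'; auto simp: xing_def xing_kind_def)

lemma arc_flip: "arc (\<not> s) a b = arc s b a"
  by (simp add: arc_def)

lemma colored_at_cong:
  "(\<And>e. e \<in> set_node n \<Longrightarrow> f' (g e) = f e) \<Longrightarrow> colored_at ut ot f' (map_node g n) = colored_at ut ot f n"
  by (cases "(ut, ot, f, n)" rule: colored_at.cases) auto

definition triangle :: "bool \<Rightarrow> bool \<Rightarrow> bool \<Rightarrow> height \<Rightarrow> height \<Rightarrow> height \<Rightarrow>
    'e \<Rightarrow> 'e \<Rightarrow> 'e \<Rightarrow> 'e \<Rightarrow> 'e \<Rightarrow> 'e \<Rightarrow> 'e \<Rightarrow> 'e \<Rightarrow> 'e \<Rightarrow> 'e node list" where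
  "triangle s1 s2 s3 c12 c13 c23 t1 t2 t3 b1 b2 b3 p q r =
     [xing c12 s1 s2 t1 t2 p q, xing c13 s1 s3 q t3 r b1, xing c23 s2 s3 p r b3 b2]"

definition triangle' :: "bool \<Rightarrow> bool \<Rightarrow> bool \<Rightarrow> height \<Rightarrow> height \<Rightarrow> height \<Rightarrow>
    'e \<Rightarrow> 'e \<Rightarrow> 'e \<Rightarrow> 'e \<Rightarrow> 'e \<Rightarrow> 'e \<Rightarrow> 'e \<Rightarrow> 'e \<Rightarrow> 'e \<Rightarrow> 'e node list" where
  "triangle' s1 s2 s3 c12 c13 c23 t1 t2 t3 b1 b2 b3 p q r =
     [xing c23 s2 s3 t2 t3 p q, xing c13 s1 s3 t1 p b3 r, xing c12 s1 s2 r q b2 b1]"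

text \<open>In the order \<open>t1, t2, t3, b1, b2, b3\<close> the ends run clockwise around the
  region, so a rotation by 60 degrees shifts them cyclically. It interchanges the two sides of the
  move.\<close>

lemma mset_triangle_rotate:
  "mset (triangle s2 s3 (\<not> s1) c23 (swap c12) (swap c13) t2 t3 b1 b2 b3 t1 p q r) =
     mset (triangle' s1 s2 s3 c12 c13 c23 t1 t2 t3 b1 b2 b3 p q r)"
  "mset (triangle' s2 s3 (\<not> s1) c23 (swap c12) (swap c13) t2 t3 b1 b2 b3 t1 q r p) =
     mset (triangle s1 s2 s3 c12 c13 c23 t1 t2 t3 b1 b2 b3 p q r)"
  by (simp_all add: triangle_def triangle'_def xing_rotate[of c12 s1 s2] xing_rotate[of c13 s1 s3])

context biquandle_virtual_bracket
begin

lemma bracket_arc: "bracket f (arc s a b # ns) r = bracket f ns (insert (a, b) r)"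
proof -
  have "bracket f ns (insert (b, a) r) = bracket f ns (insert (a, b) r)"
    by (rule bracket_symmetric_cong) auto
  then show ?thesis
    by (simp add: arc_def)
qed

lemma bracket_I:
  assumes "finite r" and "e \<notin> Field r \<union> {t, b}" and "f t = f b"
    and "X = xing c s s e t e b \<or> X = xing c s s t e b e"
  shows "bracket f [X] r * unit_powi w (sign X) = bracket f [arc s t b] r"
proof -
  let ?\<phi> = "(!) [t, b, e]"
  have inner: "inner ?\<phi> 3 [2] r"
    using assms(1,2) by (auto simp: inner_def numeral_eq_Suc less_Suc_eq)
  have "bracket f [X] (picture ?\<phi> [] r) * unit_powi w (sign X) = loops ?\<phi> r [(0, 1)]"
    by (rule reidemeister_I_picture[OF inner]) (use assms(3,4) in auto)
  then show ?thesis
    by (simp add: picture_Nil loops_def picture_def bracket_arc del: bracket.simps(2))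
qed

lemma bracket_II:
  assumes "finite r" and "{p, q} \<inter> (Field r \<union> {t1, b1, t2, b2}) = {}" and "p \<noteq> q"
    and "f t1 = f b1" and "f t2 = f b2"
  shows "bracket f [xing c s1 s2 t1 t2 p q, xing (swap c) s2 s1 p q b1 b2] r =
    bracket f [arc s1 t1 b1, arc s2 t2 b2] r"
proof -
  let ?\<phi> = "(!) [t1, b1, t2, b2, p, q]"
  have inner: "inner ?\<phi> 6 [4, 5] r"
    using assms(1-3) by (auto simp: inner_def numeral_eq_Suc less_Suc_eq)
  have "bracket f [xing c s1 s2 (?\<phi> 0) (?\<phi> 2) (?\<phi> 4) (?\<phi> 5),
      xing (swap c) s2 s1 (?\<phi> 4) (?\<phi> 5) (?\<phi> 1) (?\<phi> 3)]
      (picture ?\<phi> [] r) = loops ?\<phi> r [(0, 1), (2, 3)]"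
    by (rule reidemeister_II_picture[OF inner]) (use assms(4,5) in auto)
  moreover have "loops ?\<phi> r [(0, 1), (2, 3)] = bracket f [arc s1 t1 b1, arc s2 t2 b2] r"
    by (simp add: loops_def picture_def bracket_arc insert_commute del: bracket.simps(2))
  ultimately show ?thesis
    by (simp add: picture_Nil del: bracket.simps(2))
qed

text \<open>Read backwards, this inserts plain arcs at two ends of a picture, on which a II-move can
  then be performed.\<close>

lemma bracket_two_arcs:
  assumes "u1 \<notin> Field r" "u2 \<notin> Field r" "u1 \<noteq> u2" "{u1, u2} \<inter> {k1, k2} = {}"
    and "{u1, u2} \<subseteq> edges (mset ns)" and "f k1 = f u1" "f k2 = f u2"
  shows "bracket f (arc s1 k1 u1 # arc s2 k2 u2 # ns) r =
    bracket f (map (map_node (\<lambda>e. if e = u1 then k1 else if e = u2 then k2 else e)) ns) r"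
proof -
  let ?\<sigma> = "\<lambda>e. if e = u2 then k2 else e" and ?\<tau> = "\<lambda>e. if e = u1 then k1 else e"
  have "bracket f (arc s1 k1 u1 # arc s2 k2 u2 # ns) r =
      bracket f ns (insert (k2, u2) (insert (k1, u1) r))"
    by (simp add: bracket_arc del: bracket.simps(2))
  also have "\<dots> = bracket f (map (map_node ?\<sigma>) ns) (insert (k1, u1) r)"
    by (rule bracket_merge[OF _ refl]) (use assms in \<open>auto simp: Field_insert image_iff intro!: bexI[of _ u2]\<close>)
  also have "\<dots> = bracket f (map (map_node ?\<tau>) (map (map_node ?\<sigma>) ns)) r"
    by (rule bracket_merge[OF _ refl]) (use assms in \<open>auto simp: edges_image_mset image_iff intro!: bexI[of _ u1]\<close>)
  also have "map (map_node ?\<tau>) (map (map_node ?\<sigma>) ns) =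
      map (map_node (\<lambda>e. if e = u1 then k1 else if e = u2 then k2 else e)) ns"
    using assms(3,4) by (auto simp: node.map_comp comp_def intro!: node.map_cong)
  finally show ?thesis .
qed

text \<open>The edges are pairs whose second component is the color, which provides new edges of every color.\<close>

definition invariant_III :: "bool \<Rightarrow> bool \<Rightarrow> bool \<Rightarrow> height \<Rightarrow> height \<Rightarrow> height \<Rightarrow> bool" where
  "invariant_III s1 s2 s3 c12 c13 c23 \<longleftrightarrow>
     (\<forall>(t1 :: nat \<times> 'x) t2 t3 b1 b2 b3 p q r p' q' r' \<rho> T T'.
        T = triangle s1 s2 s3 c12 c13 c23 t1 t2 t3 b1 b2 b3 p q r \<longrightarrow>
        T' = triangle' s1 s2 s3 c12 c13 c23 t1 t2 t3 b1 b2 b3 p' q' r' \<longrightarrow>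
        finite \<rho> \<longrightarrow> distinct [p, q, r, p', q', r'] \<longrightarrow>
        {p, q, r, p', q', r'} \<inter> (Field \<rho> \<union> {t1, t2, t3, b1, b2, b3}) = {} \<longrightarrow>
        (\<forall>n. n \<in> set (T @ T') \<longrightarrow> colored_at (\<rhd>\<^sub>u) (\<rhd>\<^sub>o) snd n) \<longrightarrow>
        bracket snd T \<rho> = bracket snd T' \<rho>)"

lemma invariant_IIID:
  fixes t1 :: "nat \<times> 'x"
  assumes "invariant_III s1 s2 s3 c12 c13 c23"
    and "T = triangle s1 s2 s3 c12 c13 c23 t1 t2 t3 b1 b2 b3 p q r"
    and "T' = triangle' s1 s2 s3 c12 c13 c23 t1 t2 t3 b1 b2 b3 p' q' r'"
    and "finite \<rho>" and "distinct [p, q, r, p', q', r']"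
    and "{p, q, r, p', q', r'} \<inter> (Field \<rho> \<union> {t1, t2, t3, b1, b2, b3}) = {}"
    and "\<And>n. n \<in> set (T @ T') \<Longrightarrow> colored_at (\<rhd>\<^sub>u) (\<rhd>\<^sub>o) snd n"
  shows "bracket snd T \<rho> = bracket snd T' \<rho>"
  by (rule assms(1)[unfolded invariant_III_def, rule_format, OF assms(2-7)])

lemma invariant_IIII:
  assumes "\<And>(t1 :: nat \<times> 'x) t2 t3 b1 b2 b3 p q r p' q' r' \<rho> T T'.
    \<lbrakk>T = triangle s1 s2 s3 c12 c13 c23 t1 t2 t3 b1 b2 b3 p q r;
     T' = triangle' s1 s2 s3 c12 c13 c23 t1 t2 t3 b1 b2 b3 p' q' r';
     finite \<rho>; distinct [p, q, r, p', q', r'];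
     {p, q, r, p', q', r'} \<inter> (Field \<rho> \<union> {t1, t2, t3, b1, b2, b3}) = {};
     \<And>n. n \<in> set (T @ T') \<Longrightarrow> colored_at (\<rhd>\<^sub>u) (\<rhd>\<^sub>o) snd n\<rbrakk> \<Longrightarrow>
    bracket snd T \<rho> = bracket snd T' \<rho>"
  shows "invariant_III s1 s2 s3 c12 c13 c23"
  unfolding invariant_III_def by (intro allI impI, rule assms) (assumption | iprover)+

lemma inner_triangle:
  assumes "finite \<rho>" "distinct [p, q, r, p', q', r']"
    and "{p, q, r, p', q', r'} \<inter> (Field \<rho> \<union> {t1, t2, t3, b1, b2, b3}) = {}"
  shows "inner ((!) [t1, t2, t3, b1, b2, b3, p, q, r, p', q', r']) 12 [6, 7, 8, 9, 10, 11] \<rho>"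
  using assms by (auto simp: inner_def numeral_eq_Suc less_Suc_eq)

lemma invariant_III_braid: "invariant_III True True True SecondOver SecondOver SecondOver"
proof (rule invariant_IIII, goal_cases)
  case (1 t1 t2 t3 b1 b2 b3 p q r p' q' r' \<rho> T T')
  have "\<forall>n\<in>set (T @ T'). colored_at (\<rhd>\<^sub>u) (\<rhd>\<^sub>o) snd n"
    using 1(6) by blast
  then show ?case
    using braid_picture[OF inner_triangle[OF 1(3-5)], of snd]
    by (simp add: 1(1,2) triangle_def triangle'_def xing_def xing_kind_def picture_Nil del: bracket.simps)
qed

lemma invariant_III_mixed: "invariant_III s1 s2 s3 c NoneOver NoneOver"
proof (rule invariant_IIII, goal_cases)
  case (1 t1 t2 t3 b1 b2 b3 p q r p' q' r' \<rho> T T')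
  have virtual: "colored_at (\<rhd>\<^sub>u) (\<rhd>\<^sub>o) snd (xing NoneOver s s' nw ne sw se) \<longleftrightarrow>
      snd nw = snd se \<and> snd ne = snd sw"
    for s s' and nw ne sw se :: "nat \<times> 'x"
    by (auto simp: xing_def xing_kind_def)
  have "\<forall>n\<in>set (T @ T'). colored_at (\<rhd>\<^sub>u) (\<rhd>\<^sub>o) snd n"
    using 1(6) by blast
  then show ?case
    using mixed_picture[OF inner_triangle[OF 1(3-5)], of snd c s1 s2 s3]
    by (simp add: 1(1,2) triangle_def triangle'_def virtual picture_Nil del: bracket.simps)
qed

lemma invariant_III_rotate:
  "invariant_III s1 s2 s3 c12 c13 c23 \<longleftrightarrow> invariant_III s2 s3 (\<not> s1) c23 (swap c12) (swap c13)"
proof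
  assume inv: "invariant_III s1 s2 s3 c12 c13 c23"
  show "invariant_III s2 s3 (\<not> s1) c23 (swap c12) (swap c13)"
  proof (rule invariant_IIII, goal_cases)
    case (1 t2 t3 b1 b2 b3 t1 p q r p' q' r' \<rho> T T')
    let ?L = "triangle s1 s2 s3 c12 c13 c23 t1 t2 t3 b1 b2 b3 r' p' q'"
    let ?R = "triangle' s1 s2 s3 c12 c13 c23 t1 t2 t3 b1 b2 b3 p q r"
    have eq: "mset T = mset ?R" "mset T' = mset ?L"
      unfolding 1(1,2) by (rule mset_triangle_rotate)+
    have "bracket snd ?L \<rho> = bracket snd ?R \<rho>"
      by (rule invariant_IIID[OF inv refl refl 1(3)])
        (use 1(4-6) eq[THEN mset_eq_setD] in auto)
    then show ?case
      unfolding bracket_mset_cong[OF eq(1)] bracket_mset_cong[OF eq(2)] by simp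
  qed
next
  assume inv: "invariant_III s2 s3 (\<not> s1) c23 (swap c12) (swap c13)"
  show "invariant_III s1 s2 s3 c12 c13 c23"
  proof (rule invariant_IIII, goal_cases)
    case (1 t1 t2 t3 b1 b2 b3 p q r p' q' r' \<rho> T T')
    let ?L = "triangle s2 s3 (\<not> s1) c23 (swap c12) (swap c13) t2 t3 b1 b2 b3 t1 p' q' r'"
    let ?R = "triangle' s2 s3 (\<not> s1) c23 (swap c12) (swap c13) t2 t3 b1 b2 b3 t1 q r p"
    have eq: "mset T = mset ?R" "mset T' = mset ?L"
      unfolding 1(1,2) mset_triangle_rotate by (rule refl)+
    have "bracket snd ?L \<rho> = bracket snd ?R \<rho>"
      by (rule invariant_IIID[OF inv refl refl 1(3)])
        (use 1(4-6) eq[THEN mset_eq_setD] in auto)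
    then show ?case
      unfolding bracket_mset_cong[OF eq(1)] bracket_mset_cong[OF eq(2)] by simp
  qed
qed

lemma fresh_edge:
  fixes M :: "(nat \<times> 'x) set"
  assumes "finite M"
  obtains e where "e \<notin> M" and "snd e = x"
proof -
  obtain n where "n \<notin> fst ` M"
    using ex_new_if_finite[of "fst ` M"] assms by auto
  then show ?thesis
    using that[of "(n, x)"] by force
qed

text \<open>A II-move below the left-hand triangle makes the strands 1 and 2 cross there, the move III carries the
  third strand across, and the two crossings that are now at the top cancel by another II-move.\<close>

lemma invariant_III_exchange:
  assumes inv: "invariant_III s1 s2 s3 c12 c13 c23"
  shows "invariant_III s2 s1 s3 (swap c12) c23 c13"
proof (rule invariant_IIII, goal_cases)
  case (1 t1 t2 t3 b1 b2 b3 p q r p' q' r' \<rho> T T')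
  define E where "E = Field \<rho> \<union> {t1, t2, t3, b1, b2, b3, p, q, r, p', q', r'}"
  have fin: "finite E"
    using 1(3) by (simp add: E_def finite_Field)
  \<comment> \<open>\<open>m1\<close>, \<open>m2\<close> will separate the picture from the II-move
    at the bottom, \<open>u1\<close>, \<open>u2\<close> from the one at the top; each has the color
    of the end that it extends.\<close>
  obtain m1 where m1: "m1 \<notin> E" "snd m1 = snd b1"
    using fresh_edge[OF fin] by blast
  obtain m2 where m2: "m2 \<notin> insert m1 E" "snd m2 = snd b2"
    using fresh_edge[of "insert m1 E"] fin by blast
  obtain u1 where u1: "u1 \<notin> insert m1 (insert m2 E)" "snd u1 = snd t1"
    using fresh_edge[of "insert m1 (insert m2 E)"] fin by blast
  obtain u2 where u2: "u2 \<notin> insert m1 (insert m2 (insert u1 E))" "snd u2 = snd t2"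
    using fresh_edge[of "insert m1 (insert m2 (insert u1 E))"] fin by blast
  let ?X = "xing (swap c12) s2 s1 t1 t2 p q" and ?Y = "xing (swap c12) s2 s1 r' q' b2 b1"
  let ?bottom = "[xing c12 s1 s2 m2 m1 r' q', xing (swap c12) s2 s1 r' q' b2 b1]"
  let ?top = "[xing (swap c12) s2 s1 t1 t2 p q, xing (swap (swap c12)) s1 s2 p q u1 u2]"
  \<comment> \<open>The old inner edges \<open>p\<close>, \<open>q\<close> and \<open>q'\<close>,
    \<open>r'\<close> serve as ends here: they lie between the two crossings of the
    II-moves.\<close>
  let ?L = "triangle s1 s2 s3 c12 c13 c23 p q t3 q' r' b3 u1 u2 p'"
  let ?R = "triangle' s1 s2 s3 c12 c13 c23 p q t3 q' r' b3 r m1 m2"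
  let ?N = "[xing (swap c12) s2 s1 t1 t2 p q, xing c23 s2 s3 q t3 r m1, xing c13 s1 s3 p r b3 m2]"
  let ?N' = "[xing c13 s1 s3 u2 t3 p' q', xing c23 s2 s3 u1 p' b3 r', ?Y]"
  note fresh = m1(1) m2(1) u1(1) u2(1) 1(4,5)
  have colored: "\<forall>n\<in>set (T @ T'). colored_at (\<rhd>\<^sub>u) (\<rhd>\<^sub>o) snd n"
    using 1(6) by blast
  have new: "e \<noteq> m1" "e \<noteq> m2" "e \<noteq> u1" "e \<noteq> u2" if "e \<in> E" for e
    using fresh that by auto
  have new': "m1 \<noteq> m2" "m1 \<noteq> u1" "m1 \<noteq> u2" "m2 \<noteq> u1" "m2 \<noteq> u2" "u1 \<noteq> u2"
    using fresh by auto
  have old: "e \<in> E" if "e \<in> {t1, t2, t3, b1, b2, b3, p, q, r, p', q', r'}" for e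
    using that unfolding E_def by blast
  have ends: "snd b2 = snd m2" "snd b1 = snd m1" "snd t1 = snd u1" "snd t2 = snd u2"
    using m1 m2 u1 u2 by simp_all
  \<comment> \<open>The crossings created by the II-moves are reflections of crossings of
    \<open>T\<close> and \<open>T'\<close>, so the given colors fit them.\<close>
  have cross: "colored_at (\<rhd>\<^sub>u) (\<rhd>\<^sub>o) snd (xing c12 s1 s2 p q t1 t2)"
    "colored_at (\<rhd>\<^sub>u) (\<rhd>\<^sub>o) snd (xing c12 s1 s2 b2 b1 r' q')"
    using colored by (simp_all add: 1(1,2) triangle_def triangle'_def colored_at_flip)
  have colored_new: "colored_at (\<rhd>\<^sub>u) (\<rhd>\<^sub>o) snd n" if "n \<in> set (?L @ ?R)" for n
  proof -
    have "colored_at (\<rhd>\<^sub>u) (\<rhd>\<^sub>o) snd (xing c12 s1 s2 p q u1 u2)"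
      using cross(1) ends by (subst colored_at_xing_cong[of snd p p q q u1 t1 u2 t2]) simp_all
    moreover have "colored_at (\<rhd>\<^sub>u) (\<rhd>\<^sub>o) snd (xing c13 s1 s3 u2 t3 p' q')"
      using colored ends by (subst colored_at_xing_cong[of snd u2 t2 t3 t3 p' p' q' q'])
        (simp_all add: 1(2) triangle'_def)
    moreover have "colored_at (\<rhd>\<^sub>u) (\<rhd>\<^sub>o) snd (xing c23 s2 s3 u1 p' b3 r')"
      using colored ends by (subst colored_at_xing_cong[of snd u1 t1 p' p' b3 b3 r' r'])
        (simp_all add: 1(2) triangle'_def)
    moreover have "colored_at (\<rhd>\<^sub>u) (\<rhd>\<^sub>o) snd (xing c23 s2 s3 q t3 r m1)"
      using colored ends by (subst colored_at_xing_cong[of snd q q t3 t3 r r m1 b1])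
        (simp_all add: 1(1) triangle_def)
    moreover have "colored_at (\<rhd>\<^sub>u) (\<rhd>\<^sub>o) snd (xing c13 s1 s3 p r b3 m2)"
      using colored ends by (subst colored_at_xing_cong[of snd p p r r b3 b3 m2 b2])
        (simp_all add: 1(1) triangle_def)
    moreover have "colored_at (\<rhd>\<^sub>u) (\<rhd>\<^sub>o) snd (xing c12 s1 s2 m2 m1 r' q')"
      using cross(2) ends by (subst colored_at_xing_cong[of snd m2 b2 m1 b1 r' r' q' q']) simp_all
    ultimately show ?thesis
      using that by (auto simp: triangle_def triangle'_def)
  qed
  have "bracket snd (arc (\<not> s1) b2 m2 # arc (\<not> s2) b1 m1 # ?N) \<rho> =
      bracket snd (map (map_node (\<lambda>e. if e = m2 then b2 else if e = m1 then b1 else e)) ?N) \<rho>"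
    by (rule bracket_two_arcs) (use fresh new' ends in \<open>simp_all add: E_def set_node_xing\<close>)
  also have "map (map_node (\<lambda>e. if e = m2 then b2 else if e = m1 then b1 else e)) ?N = T"
    by (simp add: new new' old 1(1) triangle_def map_node_xing)
  finally have "bracket snd T \<rho> = bracket snd (arc (\<not> s1) b2 m2 # arc (\<not> s2) b1 m1 # ?N) \<rho>"
    by simp
  also have "\<dots> = bracket snd (?N @ [arc s1 m2 b2, arc s2 m1 b1]) \<rho>"
    by (rule bracket_mset_cong) (simp add: arc_flip)
  also have "\<dots> = bracket snd (?N @ ?bottom) \<rho>"
  proof -
    have "bracket snd (?N @ [arc s1 m2 b2, arc s2 m1 b1]) \<rho> * 1 = bracket snd (?N @ ?bottom) \<rho> * 1"
    proof (rule bracket_local[where E = "edges (mset ?N) \<union> Field \<rho>"], goal_cases)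
      case (1 \<rho>')
      have "bracket snd ?bottom \<rho>' = bracket snd [arc s1 m2 b2, arc s2 m1 b1] \<rho>'"
        by (rule bracket_II) (use 1 fresh ends in \<open>auto simp: E_def set_node_xing\<close>)
      then show ?case
        by (simp only: mult_1_right)
    qed (use 1(3) in simp_all)
    then show ?thesis
      by (simp only: mult_1_right)
  qed
  also have "\<dots> = bracket snd ([?X, ?Y] @ ?R) \<rho>"
    by (rule bracket_mset_cong) (simp add: triangle'_def)
  also have "\<dots> = bracket snd ([?X, ?Y] @ ?L) \<rho>"
  proof -
    have "bracket snd ([?X, ?Y] @ ?R) \<rho> * 1 = bracket snd ([?X, ?Y] @ ?L) \<rho> * 1"
    proof (rule bracket_local[where E = "edges (mset [?X, ?Y]) \<union> Field \<rho>"], goal_cases)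
      case (1 \<rho>')
      have "bracket snd ?L \<rho>' = bracket snd ?R \<rho>'"
      proof (rule invariant_IIID[OF inv refl refl 1(1)])
        show "distinct [u1, u2, p', r, m1, m2]"
          using fresh by (auto simp: E_def)
        show "{u1, u2, p', r, m1, m2} \<inter> (Field \<rho>' \<union> {p, q, t3, q', r', b3}) = {}"
          using fresh 1(2) by (auto simp: E_def set_node_xing)
      qed (rule colored_new)
      then show ?case
        by (simp only: mult_1_right)
    qed (use 1(3) in simp_all)
    then show ?thesis
      by (simp only: mult_1_right)
  qed
  also have "\<dots> = bracket snd (?N' @ ?top) \<rho>"
    by (rule bracket_mset_cong) (simp add: triangle_def)
  also have "\<dots> = bracket snd (?N' @ [arc s2 t1 u1, arc s1 t2 u2]) \<rho>"
  proof -
    have "bracket snd (?N' @ ?top) \<rho> * 1 = bracket snd (?N' @ [arc s2 t1 u1, arc s1 t2 u2]) \<rho> * 1"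
    proof (rule bracket_local[where E = "edges (mset ?N') \<union> Field \<rho>"], goal_cases)
      case (1 \<rho>')
      have "bracket snd ?top \<rho>' = bracket snd [arc s2 t1 u1, arc s1 t2 u2] \<rho>'"
        by (rule bracket_II) (use 1 fresh ends in \<open>auto simp: E_def set_node_xing\<close>)
      then show ?case
        by (simp only: mult_1_right)
    qed (use 1(3) in simp_all)
    then show ?thesis
      by (simp only: mult_1_right)
  qed
  also have "\<dots> = bracket snd (arc s2 t1 u1 # arc s1 t2 u2 # ?N') \<rho>"
    by (rule bracket_mset_cong) simp
  also have "\<dots> = bracket snd (map (map_node
    (\<lambda>e. if e = u1 then t1 else if e = u2 then t2 else e)) ?N') \<rho>"
    by (rule bracket_two_arcs) (use fresh new' ends in \<open>simp_all add: E_def set_node_xing\<close>)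
  also have "map (map_node (\<lambda>e. if e = u1 then t1 else if e = u2 then t2 else e)) ?N' = T'"
    by (simp add: new new' new'[symmetric] old 1(2) triangle'_def map_node_xing)
  finally show ?case .
qed

text \<open>Rotation brings strands 2 and 3 to the first two places, where
  \<open>invariant_III_exchange\<close> applies.\<close>

lemma invariant_III_exchange':
  "invariant_III s1 s2 s3 c12 c13 c23 \<Longrightarrow> invariant_III s1 s3 s2 c13 c12 (swap c23)"
  using invariant_III_exchange[of s2 s3 "\<not> s1" c23 "swap c12" "swap c13"]
    invariant_III_rotate[of s1 s2 s3 c12 c13 c23] invariant_III_rotate[of s1 s3 s2 c13 c12 "swap c23"]
  by simp

lemma invariant_III_reverse:
  assumes "invariant_III s1 s2 s3 c12 c13 c23"
  shows "invariant_III s1' s2' s3' c12 c13 c23"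
proof -
  \<comment> \<open>Rotation moves strand 1 to the last place and reverses it; two exchanges of
    neighbours bring it back, leaving only the reversal.\<close>
  have first: "invariant_III (\<not> s1) s2 s3 c12 c13 c23" if "invariant_III s1 s2 s3 c12 c13 c23"
    for s1 s2 s3 c12 c13 c23
    using that invariant_III_rotate[of s1 s2 s3 c12 c13 c23]
      invariant_III_exchange'[of s2 s3 "\<not> s1" c23 "swap c12" "swap c13"]
      invariant_III_exchange[of s2 "\<not> s1" s3 "swap c12" c23 c13] by simp
  have second: "invariant_III s1 (\<not> s2) s3 c12 c13 c23" if "invariant_III s1 s2 s3 c12 c13 c23"
    for s1 s2 s3 c12 c13 c23
    using that invariant_III_exchange[of s1 s2 s3 c12 c13 c23] first[of s2 s1 s3 "swap c12" c23 c13]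
      invariant_III_exchange[of "\<not> s2" s1 s3 "swap c12" c23 c13] by simp
  have third: "invariant_III s1 s2 (\<not> s3) c12 c13 c23" if "invariant_III s1 s2 s3 c12 c13 c23"
    for s1 s2 s3 c12 c13 c23
    using that invariant_III_exchange'[of s1 s2 s3 c12 c13 c23] second[of s1 s3 s2 c13 c12 "swap c23"]
      invariant_III_exchange'[of s1 "\<not> s3" s2 c13 c12 "swap c23"] by simp
  show ?thesis
    using assms first second third by (cases "s1' = s1"; cases "s2' = s2"; cases "s3' = s3"; simp; metis)
qed

lemma invariant_III:
  assumes "classical_triple c12 c13 c23 \<or> virtual_triple c12 c13 c23 \<or> mixed_triple c12 c13 c23"
  shows "invariant_III s1 s2 s3 c12 c13 c23"
proof -
  \<comment> \<open>The letters abbreviate the heights \<open>c12\<close>, \<open>c13\<close>,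
    \<open>c23\<close>. In SSS strand 3 is on top and strand 1 at the bottom; neighbour exchanges
    reach all six orders.\<close>
  have SSS: "invariant_III True True True SecondOver SecondOver SecondOver"
    by (rule invariant_III_braid)
  have FSS: "invariant_III True True True FirstOver SecondOver SecondOver"
    using invariant_III_exchange[OF SSS] by simp
  have SSF: "invariant_III True True True SecondOver SecondOver FirstOver"
    using invariant_III_exchange'[OF SSS] by simp
  have FFS: "invariant_III True True True FirstOver FirstOver SecondOver"
    using invariant_III_exchange[OF SSF] by simp
  have SFF: "invariant_III True True True SecondOver FirstOver FirstOver"
    using invariant_III_exchange'[OF FSS] by simp
  have FFF: "invariant_III True True True FirstOver FirstOver FirstOver"
    using invariant_III_exchange[OF SFF] by simp
  \<comment> \<open>Rotations carry the one crossing that may be classical to strands 1 and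
    2.\<close>
  have 23: "invariant_III s1 s2 s3 NoneOver NoneOver c" for s1 s2 s3 c
    using invariant_III_mixed[of s2 s3 "\<not> s1" c] invariant_III_rotate[of s1 s2 s3 NoneOver NoneOver c] by simp
  have 13: "invariant_III s1 s2 s3 NoneOver c NoneOver" for s1 s2 s3 c
    using 23[of s2 s3 "\<not> s1" "swap c"] invariant_III_rotate[of s1 s2 s3 NoneOver c NoneOver] by simp
  show ?thesis
    using assms
  proof (elim disjE)
    assume "classical_triple c12 c13 c23"
    then have "invariant_III True True True c12 c13 c23"
      using SSS FSS SSF FFS SFF FFF by (cases c12; cases c13; cases c23; simp add: classical_triple_def)
    then show ?thesis
      by (rule invariant_III_reverse)
  qed (auto simp: virtual_triple_def mixed_triple_def invariant_III_mixed 13 23)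
qed

end

section \<open>Invariance of the state sum\<close>

definition all_halves :: "'e node multiset \<Rightarrow> 'e half multiset" where
  "all_halves K = (\<Sum>n\<in>#K. mset (halves n))"

lemma all_halves_simps [simp]:
  "all_halves {#} = {#}" "all_halves (add_mset n K) = mset (halves n) + all_halves K"
  "all_halves (K + K') = all_halves K + all_halves K'"
  by (simp_all add: all_halves_def)

lemma set_node_halves: "e \<in> set_node n \<longleftrightarrow> In e \<in> set (halves n) \<or> Out e \<in> set (halves n)"
  by (cases n) auto

lemma edges_all_halves: "e \<in> edges K \<longleftrightarrow> In e \<in># all_halves K \<or> Out e \<in># all_halves K"
  by (induction K) (auto simp: set_node_halves)

lemma codeD:
  assumes "code K" and "e \<in> edges K"
  shows "count (all_halves K) (In e) = 1" and "count (all_halves K) (Out e) = 1"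
  using assms by (auto simp: code_def all_halves_def)

lemma code_distinct:
  assumes "code (mset ns)"
  shows "distinct ns"
proof (rule ccontr)
  assume "\<not> distinct ns"
  then obtain xs ys zs n where ns: "ns = xs @ [n] @ ys @ [n] @ zs"
    using not_distinct_decomp by blast
  obtain e where e: "In e \<in> set (halves n)"
    by (cases n) auto
  then obtain k where "count (mset (halves n)) (In e) = Suc k"
    by (metis count_eq_zero_iff not0_implies_Suc set_mset_mset)
  moreover have "all_halves (mset ns) = mset (halves n) + mset (halves n) +
      all_halves (mset (xs @ ys @ zs))"
    by (simp add: ns ac_simps)
  ultimately have "count (all_halves (mset ns)) (In e) \<ge> 2"
    by simp
  moreover have "e \<in> edges (mset ns)"
    using e by (simp add: ns edges_def set_node_halves)
  ultimately show False
    using codeD(1)[OF assms, of e] by simp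
qed

text \<open>A code contains each half exactly once, so an edge with both halves inside the region
  cannot occur outside.\<close>

lemma code_inner_edge:
  assumes "code K" and "all_halves K = {#In p, Out p#} + H"
  shows "In p \<notin># H" and "Out p \<notin># H"
proof -
  have "p \<in> edges K"
    using assms(2) by (simp add: edges_all_halves)
  then show "In p \<notin># H" "Out p \<notin># H"
    using codeD[OF assms(1), of p] assms(2) by (auto simp: not_in_iff)
qed

text \<open>A downward strand enters a node at its upper end: \<open>half_of s\<close> is the half
  at an upper end, \<open>half_of (\<not> s)\<close> the one at a lower end.\<close>

definition half_of :: "bool \<Rightarrow> 'e \<Rightarrow> 'e half" where
  "half_of s e = (if s then In e else Out e)"

lemma halves_xing: "mset (halves (xing c s s' nw ne sw se)) =
    {#half_of s nw, half_of s' ne, half_of (\<not> s') sw, half_of (\<not> s) se#}"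
  by (cases s; cases s') (auto simp: xing_def half_of_def)

lemma half_of_both: "{#half_of s e, half_of (\<not> s) e#} = {#In e, Out e#}"
  by (auto simp: half_of_def)

lemma code_inner_edge_xing:
  assumes "code K" and "all_halves K = {#half_of s p, half_of (\<not> s) p#} + H"
  shows "half_of s' e \<in># H \<Longrightarrow> e \<noteq> p" and "In e \<in># H \<Longrightarrow> e \<noteq> p" and "Out e \<in># H \<Longrightarrow> e \<noteq> p"
  using code_inner_edge[OF assms(1) assms(2)[unfolded half_of_both]]
    by (auto simp: half_of_def split: if_splits)

lemma sign_map_node [simp]: "sign (map_node g n) = sign n"
  by (cases n rule: sign.cases) auto

lemma sign_xing: "sign (xing c s s' nw ne sw se) =
    (case xing_kind c s s' of Positive \<Rightarrow> -1 | Negative \<Rightarrow> 1 | Virtual \<Rightarrow> 0)"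
  by (auto simp: xing_def split: kind.split)

lemma sign_arc [simp]: "sign (arc s t b) = 0"
  by (simp add: arc_def)

lemma fresh_I:
  assumes "code ({#xing c s s e t e b#} + N) \<or> code ({#xing c s s t e b e#} + N)"
  shows "e \<notin> edges N \<union> {t, b}"
proof -
  from assms obtain K where K: "code K"
    "all_halves K = {#half_of s e, half_of (\<not> s) e#} + ({#half_of s t, half_of (\<not> s) b#} + all_halves N)"
    by (elim disjE) (auto simp: halves_xing add_mset_commute intro: that)
  show ?thesis
    using code_inner_edge_xing[OF K] by (auto simp: edges_all_halves)
qed

lemma fresh_II:
  assumes "code ({#xing c s1 s2 t1 t2 p q, xing c' s2 s1 p q b1 b2#} + N)"
  shows "{p, q} \<inter> (edges N \<union> {t1, b1, t2, b2}) = {}" and "p \<noteq> q"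
proof -
  let ?K = "{#xing c s1 s2 t1 t2 p q, xing c' s2 s1 p q b1 b2#} + N"
  let ?H = "{#half_of s1 t1, half_of s2 t2, half_of (\<not> s1) b1, half_of (\<not> s2) b2#} + all_halves N"
  have "all_halves ?K = {#half_of s2 p, half_of (\<not> s2) p#} + ({#half_of s1 q, half_of (\<not> s1) q#} + ?H)"
    by (simp add: halves_xing add_mset_commute)
  note p = code_inner_edge_xing[OF assms this]
  have "all_halves ?K = {#half_of s1 q, half_of (\<not> s1) q#} + ({#half_of s2 p, half_of (\<not> s2) p#} + ?H)"
    by (simp add: halves_xing add_mset_commute)
  note q = code_inner_edge_xing[OF assms this]
  show "{p, q} \<inter> (edges N \<union> {t1, b1, t2, b2}) = {}" and "p \<noteq> q"
    using p(1)[of s1 t1] p(1)[of s2 t2] p(1)[of "\<not> s1" b1] p(1)[of "\<not> s2" b2] p(1)[of s1 q] p(2,3)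
      q(1)[of s1 t1] q(1)[of s2 t2] q(1)[of "\<not> s1" b1] q(1)[of "\<not> s2" b2] q(2,3)
    by (auto simp: edges_all_halves)
qed

lemma fresh_inner_edges:
  assumes "code K"
    and "all_halves K = {#half_of s p, half_of (\<not> s) p, half_of s' q, half_of (\<not> s') q,
        half_of s'' r, half_of (\<not> s'') r#} + H + all_halves N"
  shows "distinct [p, q, r]" and "{p, q, r} \<inter> edges N = {}" and "half_of u e \<in># H \<Longrightarrow> e \<notin> {p, q, r}"
proof -
  have "all_halves K = {#half_of s p, half_of (\<not> s) p#} +
      ({#half_of s' q, half_of (\<not> s') q, half_of s'' r, half_of (\<not> s'') r#} + H + all_halves N)"
    using assms(2) by simp
  note p = code_inner_edge_xing[OF assms(1) this]
  have "all_halves K = {#half_of s' q, half_of (\<not> s') q#} +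
      ({#half_of s p, half_of (\<not> s) p, half_of s'' r, half_of (\<not> s'') r#} + H + all_halves N)"
    using assms(2) by (simp add: add_mset_commute)
  note q = code_inner_edge_xing[OF assms(1) this]
  have "all_halves K = {#half_of s'' r, half_of (\<not> s'') r#} +
      ({#half_of s p, half_of (\<not> s) p, half_of s' q, half_of (\<not> s') q#} + H + all_halves N)"
    using assms(2) by (simp add: add_mset_commute)
  note r = code_inner_edge_xing[OF assms(1) this]
  show "distinct [p, q, r]"
    using p(1)[of s' q] p(1)[of s'' r] q(1)[of s'' r] by auto
  show "{p, q, r} \<inter> edges N = {}"
    using p(2,3)[of p] q(2,3)[of q] r(2,3)[of r] by (auto simp: edges_all_halves)
  show "e \<notin> {p, q, r}" if "half_of u e \<in># H"
    using p(1)[of u e] q(1)[of u e] r(1)[of u e] that by auto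
qed

lemma fresh_triangle:
  assumes "code (mset (triangle s1 s2 s3 c12 c13 c23 t1 t2 t3 b1 b2 b3 p q r) + N)"
  shows "distinct [p, q, r]" and "{p, q, r} \<inter> (edges N \<union> {t1, t2, t3, b1, b2, b3}) = {}"
proof -
  have "all_halves (mset (triangle s1 s2 s3 c12 c13 c23 t1 t2 t3 b1 b2 b3 p q r) + N) =
      {#half_of s2 p, half_of (\<not> s2) p, half_of s1 q, half_of (\<not> s1) q, half_of s3 r,
          half_of (\<not> s3) r#} +
      {#half_of s1 t1, half_of s2 t2, half_of s3 t3, half_of (\<not> s1) b1, half_of (\<not> s2) b2,
          half_of (\<not> s3) b3#} +
      all_halves N"
    by (simp add: triangle_def halves_xing add_mset_commute)
  note inner = fresh_inner_edges[OF assms this]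
  show "distinct [p, q, r]"
    by (rule inner(1))
  show "{p, q, r} \<inter> (edges N \<union> {t1, t2, t3, b1, b2, b3}) = {}"
    using inner(2) inner(3)[of s1 t1] inner(3)[of s2 t2] inner(3)[of s3 t3]
      inner(3)[of "\<not> s1" b1] inner(3)[of "\<not> s2" b2] inner(3)[of "\<not> s3" b3] by auto
qed

lemma fresh_triangle':
  assumes "code (mset (triangle' s1 s2 s3 c12 c13 c23 t1 t2 t3 b1 b2 b3 p q r) + N)"
  shows "distinct [p, q, r]" and "{p, q, r} \<inter> (edges N \<union> {t1, t2, t3, b1, b2, b3}) = {}"
proof -
  have "all_halves (mset (triangle' s1 s2 s3 c12 c13 c23 t1 t2 t3 b1 b2 b3 p q r) + N) =
      {#half_of s3 p, half_of (\<not> s3) p, half_of s2 q, half_of (\<not> s2) q, half_of s1 r,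
          half_of (\<not> s1) r#} +
      {#half_of s1 t1, half_of s2 t2, half_of s3 t3, half_of (\<not> s1) b1, half_of (\<not> s2) b2,
          half_of (\<not> s3) b3#} +
      all_halves N"
    by (simp add: triangle'_def halves_xing add_mset_commute)
  note inner = fresh_inner_edges[OF assms this]
  show "distinct [p, q, r]"
    by (rule inner(1))
  show "{p, q, r} \<inter> (edges N \<union> {t1, t2, t3, b1, b2, b3}) = {}"
    using inner(2) inner(3)[of s1 t1] inner(3)[of s2 t2] inner(3)[of s3 t3]
      inner(3)[of "\<not> s1" b1] inner(3)[of "\<not> s2" b2] inner(3)[of "\<not> s3" b3] by auto
qed

lemma map_node_triangle:
  "map (map_node g) (triangle s1 s2 s3 c12 c13 c23 t1 t2 t3 b1 b2 b3 p q r) =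
     triangle s1 s2 s3 c12 c13 c23 (g t1) (g t2) (g t3) (g b1) (g b2) (g b3) (g p) (g q) (g r)"
  "map (map_node g) (triangle' s1 s2 s3 c12 c13 c23 t1 t2 t3 b1 b2 b3 p q r) =
     triangle' s1 s2 s3 c12 c13 c23 (g t1) (g t2) (g t3) (g b1) (g b2) (g b3) (g p) (g q) (g r)"
  by (simp_all add: triangle_def triangle'_def map_node_xing)

section \<open>Invariance under a single step\<close>

context biquandle_virtual_bracket
begin

lemma fresh_triple:
  fixes M :: "(nat \<times> 'x) set"
  assumes "finite M"
  obtains p' q' r' where "distinct [p', q', r']" "{p', q', r'} \<inter> M = {}"
    "snd p' = snd p" "snd q' = snd q" "snd r' = snd r"
proof -
  obtain p' where p': "p' \<notin> M" "snd p' = snd p"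
    using fresh_edge[OF assms] by blast
  obtain q' where q': "q' \<notin> insert p' M" "snd q' = snd q"
    using fresh_edge[of "insert p' M"] assms by blast
  obtain r' where r': "r' \<notin> insert q' (insert p' M)" "snd r' = snd r"
    using fresh_edge[of "insert q' (insert p' M)"] assms by blast
  show ?thesis
    by (rule that[of p' q' r']) (use p' q' r' in auto)
qed

text \<open>The inner edges of the two sides of a move may have common names, so the two sides are compared
  through copies with new inner edges.\<close>

lemma invariant_III_independent:
  fixes t1 :: "nat \<times> 'x"
  assumes inv: "invariant_III s1 s2 s3 c12 c13 c23"
    and T: "T = triangle s1 s2 s3 c12 c13 c23 t1 t2 t3 b1 b2 b3 p q r"
    and T': "T' = triangle' s1 s2 s3 c12 c13 c23 t1 t2 t3 b1 b2 b3 p' q' r'"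
    and fin: "finite \<rho>" and distinct: "distinct [p, q, r]" "distinct [p', q', r']"
    and disjoint: "{p, q, r} \<inter> (Field \<rho> \<union> {t1, t2, t3, b1, b2, b3}) = {}"
      "{p', q', r'} \<inter> (Field \<rho> \<union> {t1, t2, t3, b1, b2, b3}) = {}"
    and colored: "\<And>n. n \<in> set (T @ T') \<Longrightarrow> colored_at (\<rhd>\<^sub>u) (\<rhd>\<^sub>o) snd n"
  shows "bracket snd T \<rho> = bracket snd T' \<rho>"
proof -
  let ?M = "Field \<rho> \<union> {t1, t2, t3, b1, b2, b3, p, q, r, p', q', r'}"
  have "finite ?M"
    using fin by (simp add: finite_Field)
  then obtain i j k where ijk: "distinct [i, j, k]" "{i, j, k} \<inter> ?M = {}"
    "snd i = snd p'" "snd j = snd q'" "snd k = snd r'"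
    by (rule fresh_triple)
  have "finite (?M \<union> {i, j, k})"
    using fin by (simp add: finite_Field)
  then obtain l m n where lmn: "distinct [l, m, n]" "{l, m, n} \<inter> (?M \<union> {i, j, k}) = {}"
    "snd l = snd p" "snd m = snd q" "snd n = snd r"
    by (rule fresh_triple)
  let ?S = "triangle s1 s2 s3 c12 c13 c23 t1 t2 t3 b1 b2 b3 l m n"
  let ?S' = "triangle' s1 s2 s3 c12 c13 c23 t1 t2 t3 b1 b2 b3 i j k"
  have cT: "\<And>x. x \<in> set T \<Longrightarrow> colored_at (\<rhd>\<^sub>u) (\<rhd>\<^sub>o) snd x"
    and cT': "\<And>x. x \<in> set T' \<Longrightarrow> colored_at (\<rhd>\<^sub>u) (\<rhd>\<^sub>o) snd x"
    using colored by simp_all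
  have cS: "colored_at (\<rhd>\<^sub>u) (\<rhd>\<^sub>o) snd x" if "x \<in> set ?S" for x
  proof -
    note cong = colored_at_xing_cong[of snd t1 t1 t2 t2 l p m q] colored_at_xing_cong[of snd m q t3 t3 n r b1 b1]
      colored_at_xing_cong[of snd l p n r b3 b3 b2 b2]
    show ?thesis
      using that cT lmn(3-5) cong by (auto simp: triangle_def T)
  qed
  have cS': "colored_at (\<rhd>\<^sub>u) (\<rhd>\<^sub>o) snd x" if "x \<in> set ?S'" for x
  proof -
    note cong = colored_at_xing_cong[of snd t2 t2 t3 t3 i p' j q'] colored_at_xing_cong[of snd t1 t1 i p' b3 b3 k r']
      colored_at_xing_cong[of snd k r' j q' b2 b2 b1 b1]
    show ?thesis
      using that cT' ijk(3-5) cong by (auto simp: triangle'_def T')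
  qed
  \<comment> \<open>Consecutive pictures in the chain \<open>T\<close>, \<open>?S'\<close>,
    \<open>?S\<close>, \<open>T'\<close> are opposite sides of the move with disjoint inner
    edges.\<close>
  have "bracket snd T \<rho> = bracket snd ?S' \<rho>"
    by (rule invariant_IIID[OF inv T refl fin]) (use distinct disjoint ijk cT cS' in auto)
  also have "\<dots> = bracket snd ?S \<rho>"
    by (rule sym, rule invariant_IIID[OF inv refl refl fin]) (use disjoint ijk lmn cS cS' in auto)
  also have "\<dots> = bracket snd T' \<rho>"
    by (rule invariant_IIID[OF inv refl T' fin]) (use distinct disjoint lmn cS cT' in auto)
  finally show ?thesis .
qed

text \<open>Tagging each edge with its color turns both colorings into \<open>snd\<close>. The tags
  agree on the ends and on the outside, while an inner name used on both sides may get two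
  tags.\<close>

lemma bracket_III:
  fixes t1 :: nat
  assumes inv: "invariant_III s1 s2 s3 c12 c13 c23"
    and T: "T = triangle s1 s2 s3 c12 c13 c23 t1 t2 t3 b1 b2 b3 p q r"
    and T': "T' = triangle' s1 s2 s3 c12 c13 c23 t1 t2 t3 b1 b2 b3 p' q' r'"
    and fin: "finite \<rho>" and distinct: "distinct [p, q, r]" "distinct [p', q', r']"
    and disjoint: "{p, q, r} \<inter> (Field \<rho> \<union> {t1, t2, t3, b1, b2, b3}) = {}"
      "{p', q', r'} \<inter> (Field \<rho> \<union> {t1, t2, t3, b1, b2, b3}) = {}"
    and colored: "\<And>n. n \<in> set T \<Longrightarrow> colored_at (\<rhd>\<^sub>u) (\<rhd>\<^sub>o) f n"
      "\<And>n. n \<in> set T' \<Longrightarrow> colored_at (\<rhd>\<^sub>u) (\<rhd>\<^sub>o) f' n"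
    and agree: "\<And>e. e \<in> Field \<rho> \<union> {t1, t2, t3, b1, b2, b3} \<Longrightarrow> f' e = f e"
  shows "bracket f T \<rho> = bracket f' T' \<rho>"
proof -
  define g where "g = (\<lambda>e. (e, f e))"
  define g' where "g' = (\<lambda>e. (e, f' e))"
  have same: "g' e = g e" if "e \<in> Field \<rho> \<union> {t1, t2, t3, b1, b2, b3}" for e
    using agree[OF that] by (simp add: g_def g'_def)
  have "map_prod g' g' ` \<rho> = map_prod g g ` \<rho>"
    by (rule image_cong) (auto simp: same FieldI1 FieldI2)
  moreover have "bracket f T \<rho> = bracket snd (map (map_node g) T) (map_prod g g ` \<rho>)"
    by (rule bracket_rename) (auto simp: g_def inj_on_def)
  moreover have "bracket f' T' \<rho> = bracket snd (map (map_node g') T') (map_prod g' g' ` \<rho>)"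
    by (rule bracket_rename) (auto simp: g'_def inj_on_def)
  moreover have "bracket snd (map (map_node g) T) (map_prod g g ` \<rho>) =
      bracket snd (map (map_node g') T') (map_prod g g ` \<rho>)"
  proof (rule invariant_III_independent[OF inv])
    show "map (map_node g) T = triangle s1 s2 s3 c12 c13 c23 (g t1) (g t2) (g t3) (g b1) (g b2)
      (g b3) (g p) (g q) (g r)"
      by (simp add: T map_node_triangle)
    show "map (map_node g') T' = triangle' s1 s2 s3 c12 c13 c23 (g t1) (g t2) (g t3) (g b1) (g b2)
      (g b3) (g' p') (g' q') (g' r')"
      by (simp add: T' map_node_triangle same)
    show "colored_at (\<rhd>\<^sub>u) (\<rhd>\<^sub>o) snd n" if "n \<in> set (map (map_node g) T @ map (map_node g') T')" for n
    proof -
      have "colored_at (\<rhd>\<^sub>u) (\<rhd>\<^sub>o) snd (map_node g m) = colored_at (\<rhd>\<^sub>u) (\<rhd>\<^sub>o) f m"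
        "colored_at (\<rhd>\<^sub>u) (\<rhd>\<^sub>o) snd (map_node g' m) = colored_at (\<rhd>\<^sub>u) (\<rhd>\<^sub>o) f' m" for m
        by (rule colored_at_cong; simp add: g_def g'_def)+
      then show ?thesis
        using that colored by auto
    qed
    have "g e \<noteq> g' e'" "g e \<noteq> g e'" if "e \<noteq> e'" for e e'
      using that by (auto simp: g_def g'_def)
    then show "{g p, g q, g r} \<inter> (Field (map_prod g g ` \<rho>) \<union> {g t1, g t2, g t3, g b1, g b2, g b3}) = {}"
      "{g' p', g' q', g' r'} \<inter> (Field (map_prod g g ` \<rho>) \<union> {g t1, g t2, g t3, g b1, g b2, g b3}) = {}"
      using disjoint unfolding Field_map_prod by (auto simp: g_def g'_def)
  qed (use fin distinct in \<open>auto simp: g_def g'_def\<close>)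
  ultimately show ?thesis
    by simp
qed

text \<open>Only move I can change the exponent of \<open>w\<close>. In move II the signs cancel,
  and in move III each pair of strands keeps height and directions and hence its sign.\<close>

lemma bracket_reidemeister:
  fixes T T' N :: "nat node multiset"
  assumes "reidemeister T M T'" and "code (T + N)" and "code (T' + N)"
    and "coloring (\<rhd>\<^sub>u) (\<rhd>\<^sub>o) T f" and "coloring (\<rhd>\<^sub>u) (\<rhd>\<^sub>o) T' f'"
    and agree: "\<And>e. e \<in> M \<union> edges N \<Longrightarrow> f' e = f e"
  obtains l l' where "mset l = T" and "mset l' = T'"
    and "\<And>r. finite r \<Longrightarrow> Field r \<subseteq> edges N \<Longrightarrow>
      bracket f l r * unit_powi w (sum_list (map sign l)) =
          bracket f' l' r * unit_powi w (sum_list (map sign l'))"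
  using assms
proof (cases rule: reidemeister.cases)
  case (I_left s t b c e)
  have "f t = f b"
    using assms(4) by (cases s) (simp_all add: I_left coloring_def arc_def)
  then have "f' t = f' b"
    using agree by (simp add: I_left)
  have new: "e \<notin> edges N \<union> {t, b}"
    by (rule fresh_I[of c s]) (use assms(3) in \<open>simp add: I_left\<close>)
  show ?thesis
  proof (rule that[of "[arc s t b]" "[xing c s s e t e b]"])
    fix r :: "(nat \<times> nat) set"
    assume "finite r" "Field r \<subseteq> edges N"
    then have "bracket f' [xing c s s e t e b] r * unit_powi w (sign (xing c s s e t e b)) =
        bracket f' [arc s t b] r"
      using new \<open>f' t = f' b\<close> by (intro bracket_I) auto
    then show "bracket f [arc s t b] r * unit_powi w (sum_list (map sign [arc s t b])) =
        bracket f' [xing c s s e t e b] r * unit_powi w (sum_list (map sign [xing c s s e t e b]))"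
      by (simp add: bracket_arc unit_powi_def del: bracket.simps(2))
  qed (simp_all add: I_left)
next
  case (I_right s t b c e)
  have "f t = f b"
    using assms(4) by (cases s) (simp_all add: I_right coloring_def arc_def)
  then have "f' t = f' b"
    using agree by (simp add: I_right)
  have new: "e \<notin> edges N \<union> {t, b}"
    by (rule fresh_I[of c s]) (use assms(3) in \<open>simp add: I_right\<close>)
  show ?thesis
  proof (rule that[of "[arc s t b]" "[xing c s s t e b e]"])
    fix r :: "(nat \<times> nat) set"
    assume "finite r" "Field r \<subseteq> edges N"
    then have "bracket f' [xing c s s t e b e] r * unit_powi w (sign (xing c s s t e b e)) =
        bracket f' [arc s t b] r"
      using new \<open>f' t = f' b\<close> by (intro bracket_I) auto
    then show "bracket f [arc s t b] r * unit_powi w (sum_list (map sign [arc s t b])) =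
        bracket f' [xing c s s t e b e] r * unit_powi w (sum_list (map sign [xing c s s t e b e]))"
      by (simp add: bracket_arc unit_powi_def del: bracket.simps(2))
  qed (simp_all add: I_right)
next
  case (II s1 t1 b1 s2 t2 b2 c p q)
  have "f t1 = f b1" "f t2 = f b2"
    using assms(4) by (cases s1; cases s2; simp add: II coloring_def arc_def)+
  then have colors: "f' t1 = f' b1" "f' t2 = f' b2"
    using agree by (simp_all add: II)
  note new = fresh_II[OF assms(3)[unfolded II]]
  let ?X = "xing c s1 s2 t1 t2 p q" and ?Y = "xing (swap c) s2 s1 p q b1 b2"
  show ?thesis
  proof (rule that[of "[arc s1 t1 b1, arc s2 t2 b2]" "[?X, ?Y]"])
    fix r :: "(nat \<times> nat) set"
    assume "finite r" "Field r \<subseteq> edges N"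
    then have "bracket f' [?X, ?Y] r = bracket f' [arc s1 t1 b1, arc s2 t2 b2] r"
      using new colors by (intro bracket_II) auto
    moreover have "sign ?X + sign ?Y = 0"
      by (cases c; cases "s1 = s2"; simp add: sign_xing xing_kind_def)
    ultimately show "bracket f [arc s1 t1 b1, arc s2 t2 b2] r *
        unit_powi w (sum_list (map sign [arc s1 t1 b1, arc s2 t2 b2])) =
        bracket f' [?X, ?Y] r * unit_powi w (sum_list (map sign [?X, ?Y]))"
      by (simp add: bracket_arc del: bracket.simps(2))
  qed (simp_all add: II)
next
  case (III c12 c13 c23 s1 s2 t1 t2 p q s3 t3 r b1 b3 b2 p' q' r')
  let ?L = "triangle s1 s2 s3 c12 c13 c23 t1 t2 t3 b1 b2 b3 p q r"
  let ?R = "triangle' s1 s2 s3 c12 c13 c23 t1 t2 t3 b1 b2 b3 p' q' r'"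
  have L: "mset ?L = T" and R: "mset ?R = T'"
    by (simp_all add: III triangle_def triangle'_def)
  note new = fresh_triangle[OF assms(2)[folded L]] fresh_triangle'[OF assms(3)[folded R]]
  show ?thesis
  proof (rule that[OF L R])
    fix \<rho> :: "(nat \<times> nat) set"
    assume \<rho>: "finite \<rho>" "Field \<rho> \<subseteq> edges N"
    have "bracket f ?L \<rho> = bracket f' ?R \<rho>"
    proof (rule bracket_III[OF invariant_III[OF III(4)] refl refl \<rho>(1) new(1,3)])
      show "colored_at (\<rhd>\<^sub>u) (\<rhd>\<^sub>o) f n" if "n \<in> set ?L" for n
        using assms(4) that unfolding L[symmetric] by (simp add: coloring_def)
      show "colored_at (\<rhd>\<^sub>u) (\<rhd>\<^sub>o) f' n" if "n \<in> set ?R" for n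
        using assms(5) that unfolding R[symmetric] by (simp add: coloring_def)
      show "f' e = f e" if "e \<in> Field \<rho> \<union> {t1, t2, t3, b1, b2, b3}" for e
        using agree[of e] that \<rho>(2) by (auto simp: III)
    qed (use new(2,4) \<rho>(2) in auto)
    moreover have "sum_list (map sign ?L) = sum_list (map sign ?R)"
      by (simp add: triangle_def triangle'_def sign_xing)
    ultimately show "bracket f ?L \<rho> * unit_powi w (sum_list (map sign ?L)) =
        bracket f' ?R \<rho> * unit_powi w (sum_list (map sign ?R))"
      by (simp only:)
  qed
qed

lemma state_sum_step:
  fixes K K' :: "nat node multiset"
  assumes "colored_step K f K' f'" and code: "code K" "code K'"
    and "coloring (\<rhd>\<^sub>u) (\<rhd>\<^sub>o) K f" and "coloring (\<rhd>\<^sub>u) (\<rhd>\<^sub>o) K' f'"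
  shows "state_sum A B C D U V \<delta> w K f = state_sum A B C D U V \<delta> w K' f'"
  using assms(1)
proof (cases rule: colored_step.cases)
  case (rename g)
  obtain ns where ns: "mset ns = K"
    using ex_mset by blast
  then have ns': "mset (map (map_node g) ns) = K'"
    by (simp add: rename)
  have "bracket f ns {} = bracket f' (map (map_node g) ns) {}"
    using bracket_rename[of g ns "{}" f' f] rename ns by simp
  moreover have "distinct ns" "distinct (map (map_node g) ns)"
    using code code_distinct ns ns' by metis+
  ultimately show ?thesis
    unfolding ns[symmetric] ns'[symmetric] by (simp add: state_sum_eq_bracket comp_def del: mset_map)
next
  case (erase_point a b N)
  define \<sigma> where "\<sigma> = (\<lambda>e. if e = b then a else e)"
  obtain ns where ns: "mset ns = N"
    using ex_mset by blast
  have K: "mset (Pt a b # ns) = K" and K': "mset (map (map_node \<sigma>) ns) = K'"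
    by (simp_all add: erase_point ns \<sigma>_def)
  have "a \<in> edges K"
    by (simp add: erase_point)
  \<comment> \<open>As \<open>a\<close> differs from \<open>b\<close>, the marked point carries only
    the half \<open>In a\<close>. The other half lies at another node, so contracting to
    \<open>a\<close> does not lose a circle.\<close>
  then have "Out a \<in># all_halves K"
    using codeD(2)[OF code(1)] by (metis count_eq_zero_iff zero_neq_one)
  then have "a \<in> edges (mset ns)"
    using erase_point(3) ns by (auto simp: erase_point edges_all_halves)
  then have a: "a \<in> \<sigma> ` edges (mset ns)"
    using erase_point(3) by (force simp: \<sigma>_def)
  have "bracket f (Pt a b # ns) {} = bracket f ns (insert (a, b) {})"
    by simp
  also have "\<dots> = bracket f (map (map_node \<sigma>) ns) {}"
    by (rule bracket_merge[OF _ \<sigma>_def]) (use assms(4) a in \<open>auto simp: erase_point coloring_def\<close>)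
  also have "\<dots> = bracket f' (map (map_node \<sigma>) ns) {}"
  proof -
    have "f' e = f e" if "e \<in> edges (mset (map (map_node \<sigma>) ns))" for e
      using that erase_point unfolding K' by blast
    then show ?thesis
      using bracket_rename[of id "map (map_node \<sigma>) ns" "{}" f' f] by (simp add: node.map_id0)
  qed
  finally have "bracket f (Pt a b # ns) {} = bracket f' (map (map_node \<sigma>) ns) {}" .
  moreover have "distinct (Pt a b # ns)" "distinct (map (map_node \<sigma>) ns)"
    using code code_distinct K K' by metis+
  ultimately show ?thesis
    unfolding K[symmetric] K'[symmetric]
    by (simp only: state_sum_eq_bracket) (simp add: comp_def del: bracket.simps)
next
  case (move T M T' N)
  obtain ns where ns: "mset ns = N"
    using ex_mset by blast
  have col: "coloring (\<rhd>\<^sub>u) (\<rhd>\<^sub>o) T f" "coloring (\<rhd>\<^sub>u) (\<rhd>\<^sub>o) T' f'"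
    using assms(4,5) by (auto simp: move coloring_def)
  obtain l l' where l: "mset l = T" "mset l' = T'"
    and eq: "\<And>r. finite r \<Longrightarrow> Field r \<subseteq> edges N \<Longrightarrow>
      bracket f l r * unit_powi w (sum_list (map sign l)) =
          bracket f' l' r * unit_powi w (sum_list (map sign l'))"
    using bracket_reidemeister[OF move(3) code[unfolded move(1,2)] col move(4)] by blast
  have K: "mset (ns @ l) = K" and K': "mset (ns @ l') = K'"
    by (simp_all add: move ns l)
  have "bracket f (ns @ l) {} * unit_powi w (sum_list (map sign l)) =
      bracket f' (ns @ l') {} * unit_powi w (sum_list (map sign l'))"
    by (rule bracket_local[OF eq]) (use move(4) ns in auto)
  then have "bracket f (ns @ l) {} * unit_powi w (sum_list (map sign (ns @ l))) =
      bracket f' (ns @ l') {} * unit_powi w (sum_list (map sign (ns @ l')))"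
    by (simp only: map_append sum_list_append unit_powi_add[OF w_unit] mult.left_commute)
  moreover have "distinct (ns @ l)" "distinct (ns @ l')"
    using code code_distinct K K' by metis+
  ultimately show ?thesis
    unfolding K[symmetric] K'[symmetric] by (simp only: state_sum_eq_bracket)
qed

end

theorem theorem2:
  fixes ut ot :: "'x \<Rightarrow> 'x \<Rightarrow> 'x"
    and A B C D U V :: "'x \<Rightarrow> 'x \<Rightarrow> 'r::comm_ring_1"
    and \<delta> w :: 'r
    and K K' :: "nat node multiset"
    and f f' :: "nat \<Rightarrow> 'x"
  assumes "biquandle_virtual_bracket ut ot A B C D U V \<delta> w"
    and "link_diagram K" and "coloring ut ot K f"
    and "link_diagram K'" and "coloring ut ot K' f'"
    and "colored_move K f K' f'"
  shows "state_sum A B C D U V \<delta> w K f = state_sum A B C D U V \<delta> w K' f'"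
proof -
  interpret biquandle_virtual_bracket ut ot A B C D U V \<delta> w
    by (rule assms(1))
  have "code K" "code K'"
    using assms(2,4) by (simp_all add: link_diagram_def)
  with assms(3,5,6) show ?thesis
    using state_sum_step[of K f K' f'] state_sum_step[of K' f' K f] by (auto simp: colored_move_def)
qed

end
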